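(* Let $d\ge 1$ and suppose that either $\lambda_1=\dots=\lambda_d=\lambda>0$ or $\lambda_1>\dots>\lambda_d>0$. Let $h:W^d\to\mathbb{R}$ be the function defined in the context for the corresponding case. Then $h(x)>0$ for all $x\in W^d$ and $$\mathbb{E}_x\big[h(S(1))\,1_{\{\tau>1\}}\big]=h(x),\qquad x\in W^d .$$
   Context: Let $(X_{ij})_{i\ge1,1\le j\le d}$ be independent exponential random variables, $X_{ij}$ having rate $\lambda_j>0$. Let $W^d=\{(x_1,\dots,x_d)\in\mathbb{R}^d: x_1\le x_2\le\dots\le x_d\}$. The random walk $S(n)=(S_1(n),\dots,S_d(n))$ started from $S(0)=x\in W^d$ is $S_j(n)=x_j+\sum_{i=1}^n X_{ij}$; $\mathbb{P}_x,\mathbb{E}_x$ denote its law and expectation. Let $\tau=\inf\{n\ge1: S(n)\notin W^d\}$. Let $\Delta(x)=\prod_{1\le i<j\le d}(x_j-x_i)$. Definition of $h$. Equal rates $\lambda_1=\dots=\lambda_d=\lambda$: let $\eta_1=0$ and let $\eta_2,\dots,\eta_d$ be independent, $\eta_j\sim\mathrm{Gamma}(j-1,\lambda)$ (shape $j-1$, rate $\lambda$); then $h(x)=\mathbb{E}[\Delta(x_1+\eta_1,\dots,x_d+\eta_d)]$. Distinct rates: $h(x)=e^{\sum_{i=1}^d\lambda_ix_i}\det\big(\lambda_i^{i-j}e^{-\lambda_ix_j}\big)_{i,j=1}^d$. *)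

theory Defs
  imports "HOL-Probability.Probability" "Jordan_Normal_Form.Determinant"
begin

text \<open>
  A point of \<open>\<real>\<^sup>d\<close> is a function \<open>nat \<Rightarrow> real\<close> of which only the coordinates \<open>1, \<dots>, d\<close> are used;
  no definition below depends on the other coordinates.
\<close>

definition weyl_chamber :: "nat \<Rightarrow> (nat \<Rightarrow> real) set" where
  "weyl_chamber d = {x. \<forall>i\<in>{1..d}. \<forall>j\<in>{1..d}. i \<le> j \<longrightarrow> x i \<le> x j}"

definition vandermonde :: "nat \<Rightarrow> (nat \<Rightarrow> real) \<Rightarrow> real" where
  "vandermonde d x = (\<Prod>j\<in>{1..d}. \<Prod>i\<in>{1..<j}. x j - x i)"

definition walk :: "(nat \<Rightarrow> nat \<Rightarrow> 'a \<Rightarrow> real) \<Rightarrow> (nat \<Rightarrow> real) \<Rightarrow> nat \<Rightarrow> 'a \<Rightarrow> nat \<Rightarrow> real" where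
  "walk X x n \<omega> = (\<lambda>j. x j + (\<Sum>i=1..n. X i j \<omega>))"

text \<open>The infimum is taken in \<open>enat\<close>, so that it is \<open>\<infinity>\<close> if the walk never leaves the chamber.\<close>

definition exit_time ::
    "nat \<Rightarrow> (nat \<Rightarrow> nat \<Rightarrow> 'a \<Rightarrow> real) \<Rightarrow> (nat \<Rightarrow> real) \<Rightarrow> 'a \<Rightarrow> enat" where
  "exit_time d X x \<omega> = (INF n\<in>{n. 1 \<le> n \<and> walk X x n \<omega> \<notin> weyl_chamber d}. enat n)"

text \<open>
  The law of \<open>\<eta>\<^sub>j\<close>: the point mass at \<open>0\<close> for \<open>j = 1\<close>, and \<open>Gamma(j - 1, l)\<close> for \<open>j \<ge> 2\<close>.
  Note that \<^term>\<open>erlang_density k l\<close> is the Gamma density with shape \<open>k + 1\<close> and rate \<open>l\<close>.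
\<close>

definition eta_law :: "real \<Rightarrow> nat \<Rightarrow> real measure" where
  "eta_law l j = (if j \<le> 1 then return borel 0 else density lborel (erlang_density (j - 2) l))"

definition h_equal :: "nat \<Rightarrow> real \<Rightarrow> (nat \<Rightarrow> real) \<Rightarrow> real" where
  "h_equal d l x =
     (\<integral>\<eta>. vandermonde d (\<lambda>j. x j + \<eta> j) \<partial>(\<Pi>\<^sub>M j\<in>{1..d}. eta_law l j))"

text \<open>
  The rows and columns of \<^term>\<open>mat d d f\<close> are numbered from \<open>0\<close>; this does not affect the
  exponent \<open>i - j\<close>.
\<close>

definition h_distinct :: "nat \<Rightarrow> (nat \<Rightarrow> real) \<Rightarrow> (nat \<Rightarrow> real) \<Rightarrow> real" where
  "h_distinct d lam x =
     exp (\<Sum>i=1..d. lam i * x i) *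
     Determinant.det (Matrix.mat d d (\<lambda>(i, j).
       lam (Suc i) powi (int i - int j) * exp (- lam (Suc i) * x (Suc j))))"

end

theory Submission
  imports Defs "HOL-Real_Asymp.Real_Asymp"
begin

text \<open>
  The event \<open>\<tau> > 1\<close> says that the first step ends in the chamber \<open>W\<close>, so the claim is an integral
  identity for one step.  In both cases \<open>h\<close> is a constant times
  \<open>exp (\<Sum> \<lambda>\<^sub>j y\<^sub>j) det (G\<^sub>j(i, y\<^sub>j\<^sub>+\<^sub>1))\<close> with rows and columns numbered from \<open>0\<close>, where \<open>- G\<^sub>j\<close> is the
  derivative of \<open>G\<^sub>j\<^sub>+\<^sub>1\<close> and \<open>G\<^sub>j\<^sub>+\<^sub>1\<close> vanishes at infinity.  For distinct rates, \<open>G\<^sub>j(i, \<cdot>)\<close> is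
  an exponential with rate \<open>\<lambda>\<^sub>i\<^sub>+\<^sub>1\<close>; for equal rates it is \<open>\<lambda>\<^sup>-\<^sup>j exp (- \<lambda> y) E[(y + \<gamma>)\<^sup>i]\<close> with
  \<open>\<gamma>\<close> of law \<open>Gamma(j, \<lambda>)\<close> (\<open>h_equal_eq_fdet\<close>).

  Harmonicity.  The exponential densities cancel the weight \<open>exp (\<Sum> \<lambda>\<^sub>j y\<^sub>j)\<close> up to constants, and
  what remains is the Lebesgue integral of the determinant over \<open>x\<^sub>j \<le> y\<^sub>j\<close>, \<open>y\<^sub>1 \<le> \<dots> \<le> y\<^sub>d\<close>.
  Integrating \<open>y\<^sub>1\<close> over \<open>[x\<^sub>1, y\<^sub>2]\<close> turns the column \<open>G\<^sub>0(y\<^sub>1)\<close> into \<open>G\<^sub>1(x\<^sub>1) - G\<^sub>1(y\<^sub>2)\<close>, and the second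
  part drops out because it equals the next column.  The same happens for \<open>y\<^sub>2, y\<^sub>3, \<dots>\<close> in this
  order; for \<open>y\<^sub>d\<close>, which has no upper bound, the decay of \<open>G\<^sub>d\<close> takes the place of the cancellation.  The result
  (\<open>nn_integral_product_exponential\<close>) is \<open>det (G\<^sub>j\<^sub>+\<^sub>1(i, x\<^sub>j\<^sub>+\<^sub>1))\<close>, and advancing all columns by one
  divides the determinant by \<open>\<lambda>\<^sub>1 \<cdots> \<lambda>\<^sub>d\<close>: for distinct rates this is a rescaling of the rows, for
  equal rates it is a unitriangular row operation together with a factor \<open>1 / \<lambda>\<close> in each column.

  Positivity.  Normalise the first row to ones and subtract from every column its left neighbour.
  This writes the determinant as an integral, against a positive measure, of determinants of the same
  kind and of size one less, at points that interlace with \<open>x\<close> (\<open>fdet_pos_of_differences\<close>), and induction applies.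
  The same positivity makes the integrand above nonnegative, which justifies iterating the integral.
\<close>

section \<open>Determinants given by functions of row and column\<close>

abbreviation fdet :: "nat \<Rightarrow> (nat \<Rightarrow> nat \<Rightarrow> real) \<Rightarrow> real" where
  "fdet n a \<equiv> Determinant.det (Matrix.mat n n (\<lambda>(i, j). a i j))"

lemma fdet_cong:
  assumes "\<And>i j. i < n \<Longrightarrow> j < n \<Longrightarrow> a i j = b i j"
  shows "fdet n a = fdet n b"
  by (rule arg_cong[where f = Determinant.det]) (use assms in \<open>auto intro!: eq_matI\<close>)

lemma fdet_leibniz:
  "fdet n a = (\<Sum>p | p permutes {0..<n}. signof p * (\<Prod>i=0..<n. a i (p i)))"
proof -
  have "p i < n" if "p permutes {0..<n}" "i < n" for p i
    using permutes_in_image[OF that(1), of i] that(2) by auto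
  then show ?thesis
    by (subst det_def'[of _ n]) (auto intro!: sum.cong prod.cong)
qed

lemma fdet_transpose: "fdet n (\<lambda>i j. a j i) = fdet n a"
proof -
  have "transpose_mat (Matrix.mat n n (\<lambda>(i, j). a i j)) = Matrix.mat n n (\<lambda>(i, j). a j i)"
    by (auto intro!: eq_matI)
  then show ?thesis
    using det_transpose[of "Matrix.mat n n (\<lambda>(i, j). a i j)" n] by simp
qed

lemma fdet_scale_rows: "fdet n (\<lambda>i j. c i * a i j) = (\<Prod>i<n. c i) * fdet n a"
  by (simp add: fdet_leibniz prod.distrib sum_distrib_left mult_ac lessThan_atLeast0)

lemma fdet_scale_cols: "fdet n (\<lambda>i j. c j * a i j) = (\<Prod>j<n. c j) * fdet n a"
  using fdet_scale_rows[of n c "\<lambda>i j. a j i"]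
  by (simp only: fdet_transpose[of n a] fdet_transpose[of n "\<lambda>i j. c j * a i j"])

text \<open>
  The modified matrix is \<open>L A\<close> with \<open>L\<close> lower bidiagonal and unit diagonal.  Row \<open>i\<close> receives the
  original row \<open>i - 1\<close>, all rows being changed at the same time.  This one operation gives the Vandermonde formula, the column differences behind positivity, and the
  invariance of the Gamma moment determinant under a shift of the shape parameter.
\<close>

lemma fdet_add_prev_row:
  "fdet n (\<lambda>i j. a i j + (if i = 0 then 0 else c i * a (i - 1) j)) = fdet n a"
proof -
  let ?L = "Matrix.mat n n (\<lambda>(i, j). if j = i then 1 else if Suc j = i then c i else 0)"
  let ?A = "Matrix.mat n n (\<lambda>(i, j). a i j)"
  have "Determinant.det ?L = prod_list (diag_mat ?L)"
    by (rule det_lower_triangular[of n]) auto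
  also have "\<dots> = 1"
    by (simp add: prod_list_diag_prod)
  finally have L: "Determinant.det ?L = 1" .
  have "Matrix.mat n n (\<lambda>(i, j). a i j + (if i = 0 then 0 else c i * a (i - 1) j)) = ?L * ?A"
  proof (rule eq_matI)
    fix i j assume "i < dim_row (?L * ?A)" "j < dim_col (?L * ?A)"
    then have ij: "i < n" "j < n" by auto
    have "(?L * ?A) $$ (i, j) =
        (\<Sum>k<n. (if k = i then 1 else if Suc k = i then c i else 0) * a k j)"
      using ij by (simp add: scalar_prod_def lessThan_atLeast0 cong: if_cong)
    also have "\<dots> = (\<Sum>k<n. if k = i then a k j else 0) +
        (\<Sum>k<n. if Suc k = i then c i * a k j else 0)"
      by (subst sum.distrib[symmetric], rule sum.cong) auto
    also have "(\<Sum>k<n. if k = i then a k j else 0) = a i j"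
      using ij by simp
    also have "(\<Sum>k<n. if Suc k = i then c i * a k j else 0) =
        (if i = 0 then 0 else c i * a (i - 1) j)"
      using ij by (cases i) (simp_all add: sum.delta)
    finally show "Matrix.mat n n (\<lambda>(i, j). a i j + (if i = 0 then 0 else c i * a (i - 1) j)) $$ (i, j)
        = (?L * ?A) $$ (i, j)"
      using ij by simp
  qed auto
  then show ?thesis
    using L det_mult[of ?L n ?A] by simp
qed

lemma fdet_add_prev_col:
  "fdet n (\<lambda>i j. a i j + (if j = 0 then 0 else c j * a i (j - 1))) = fdet n a"
  using fdet_add_prev_row[of n "\<lambda>i j. a j i" c]
  by (simp only: fdet_transpose[of n a]
      fdet_transpose[of n "\<lambda>i j. a i j + (if j = 0 then 0 else c j * a i (j - 1))"])

text \<open>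
  Laplace expansion: the cofactors of column \<open>k\<close> do not involve that column.  In this form,
  derivatives, limits and sums in a single column pass through the determinant.
\<close>

lemma fdet_linear_col:
  assumes "k < n"
  shows "\<exists>c. \<forall>v. fdet n (\<lambda>i j. if j = k then v i else a i j) = (\<Sum>i<n. c i * v i)"
proof (intro exI allI)
  fix v
  let ?V = "Matrix.mat n n (\<lambda>(i, j). if j = k then v i else a i j)"
  have "mat_delete ?V i k = mat_delete (Matrix.mat n n (\<lambda>(i, j). a i j)) i k" for i
    using assms by (auto intro!: eq_matI simp: mat_delete_def)
  then have "cofactor ?V i k = cofactor (Matrix.mat n n (\<lambda>(i, j). a i j)) i k" for i
    by (simp add: cofactor_def)
  then show "fdet n (\<lambda>i j. if j = k then v i else a i j) =
      (\<Sum>i<n. cofactor (Matrix.mat n n (\<lambda>(i, j). a i j)) i k * v i)"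
    using assms by (subst laplace_expansion_column[of _ n k]) (auto intro!: sum.cong)
qed

lemma fdet_eq_cols:
  assumes "k < n" "l < n" "k \<noteq> l" "\<And>i. i < n \<Longrightarrow> a i k = a i l"
  shows "fdet n a = 0"
  by (rule det_identical_columns[of _ n k l]) (use assms in \<open>auto simp: Matrix.col_def intro!: eq_vecI\<close>)

lemma fdet_first_row_unit:
  assumes "a 0 0 = 1" "\<And>j. j < n \<Longrightarrow> a 0 (Suc j) = 0"
  shows "fdet (Suc n) a = fdet n (\<lambda>i j. a (Suc i) (Suc j))"
proof -
  let ?A = "Matrix.mat (Suc n) (Suc n) (\<lambda>(i, j). a i j)"
  have "Determinant.det ?A = (\<Sum>j<Suc n. a 0 j * cofactor ?A 0 j)"
    by (subst laplace_expansion_row[of _ "Suc n" 0]) auto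
  also have "\<dots> = cofactor ?A 0 0"
    using assms by (simp add: sum.lessThan_Suc_shift del: sum.lessThan_Suc)
  also have "\<dots> = fdet n (\<lambda>i j. a (Suc i) (Suc j))"
    by (auto simp: cofactor_def mat_delete_def intro!: arg_cong[where f = Determinant.det] eq_matI)
  finally show ?thesis .
qed

lemma fdet_vandermonde:
  "fdet n (\<lambda>i j. z j ^ i) = (\<Prod>j<n. \<Prod>i<j. z j - z i)"
proof (induction n arbitrary: z)
  case (Suc n)
  \<comment> \<open>Subtracting \<open>z 0\<close> times the previous row annihilates the first column below its top entry and
    leaves the factor \<open>z j - z 0\<close> in every other column.\<close>
  let ?b = "\<lambda>i j. z j ^ i + (if i = 0 then 0 else - z 0 * z j ^ (i - 1))"
  have "fdet (Suc n) (\<lambda>i j. z j ^ i) = fdet (Suc n) ?b"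
    using fdet_add_prev_row[of "Suc n" "\<lambda>i j. z j ^ i" "\<lambda>_. - z 0"] by simp
  also have "\<dots> = fdet (Suc n) (\<lambda>i j. ?b j i)"
    by (rule fdet_transpose[symmetric])
  also have "\<dots> = fdet n (\<lambda>i j. ?b (Suc j) (Suc i))"
    by (rule fdet_first_row_unit) (auto simp: algebra_simps)
  also have "\<dots> = fdet n (\<lambda>i j. (z (Suc i) - z 0) * z (Suc i) ^ j)"
    by (rule fdet_cong) (simp add: algebra_simps)
  also have "\<dots> = (\<Prod>i<n. z (Suc i) - z 0) * fdet n (\<lambda>i j. z (Suc i) ^ j)"
    by (rule fdet_scale_rows)
  also have "fdet n (\<lambda>i j. z (Suc i) ^ j) = fdet n (\<lambda>i j. z (Suc j) ^ i)"
    by (rule fdet_transpose)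
  also have "\<dots> = (\<Prod>j<n. \<Prod>i<j. z (Suc j) - z (Suc i))"
    by (rule Suc.IH)
  finally show ?case
    by (simp add: prod.lessThan_Suc_shift prod.distrib del: prod.lessThan_Suc)
qed simp

section \<open>Positivity by subtracting adjacent columns\<close>

text \<open>
  Subtracting from every column its left neighbour turns the first row into \<open>1, 0, \<dots>, 0\<close> and leaves
  the columns \<open>u\<^sub>j\<^sub>+\<^sub>1(x\<^sub>j\<^sub>+\<^sub>1) - u\<^sub>j(x\<^sub>j)\<close>.  By the differential equation,
  \<open>u\<^sub>j\<^sub>+\<^sub>1(x\<^sub>j\<^sub>+\<^sub>1) - u\<^sub>j(x\<^sub>j) = v\<^sub>j(x\<^sub>j) + r \<integral> v\<^sub>j(t) dt\<close> over \<open>[x\<^sub>j, x\<^sub>j\<^sub>+\<^sub>1]\<close>, where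
  \<open>v\<^sub>j = u\<^sub>j\<^sub>+\<^sub>1 - u\<^sub>j\<close>.  So the determinant is an integral, with respect to a positive measure, of
  determinants of size one less with columns \<open>v\<^sub>j(y\<^sub>j)\<close>, where \<open>y\<^sub>j\<close> lies in \<open>[x\<^sub>j, x\<^sub>j\<^sub>+\<^sub>1]\<close>.  Such
  \<open>y\<close> are again increasing, which makes the statement fit for an induction on the size.
\<close>

lemma fdet_pos_of_differences:
  fixes u :: "nat \<Rightarrow> nat \<Rightarrow> real \<Rightarrow> real"
  assumes x: "\<And>j. j < n \<Longrightarrow> x j \<le> x (Suc j)"
    and one: "\<And>j y. u j 0 y = 1"
    and r: "0 \<le> r"
    and der: "\<And>j i y. i < n \<Longrightarrow>
      (u (Suc j) (Suc i) has_real_derivative r * (u (Suc j) (Suc i) y - u j (Suc i) y)) (at y)"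
    and pos: "\<And>y. (\<And>j. Suc j < n \<Longrightarrow> y j \<le> y (Suc j)) \<Longrightarrow>
      0 < fdet n (\<lambda>i j. u (Suc j) (Suc i) (y j) - u j (Suc i) (y j))"
  shows "0 < fdet (Suc n) (\<lambda>i j. u j i (x j))"
proof -
  define v where "v j i y = u (Suc j) (Suc i) y - u j (Suc i) y" for j i y
  define w where "w j i = u (Suc j) (Suc i) (x (Suc j)) - u j (Suc i) (x j)" for j i
  \<comment> \<open>The multiple integral is avoided by passing from \<open>v\<^sub>j(y\<^sub>j)\<close> to the difference \<open>w\<^sub>j\<close> in one column
    at a time: the determinant is linear in that column, and monotonicity replaces the integral.\<close>
  have mixed: "0 < fdet n (\<lambda>i j. if j < k then w j i else v j i (y j))"
    if "k \<le> n" "\<And>j. j < n \<Longrightarrow> x j \<le> y j" "\<And>j. j < n \<Longrightarrow> y j \<le> x (Suc j)" for k y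
    using that
  proof (induction k arbitrary: y)
    case 0
    have "0 < fdet n (\<lambda>i j. u (Suc j) (Suc i) (y j) - u j (Suc i) (y j))"
    proof (rule pos[of y])
      fix j assume "Suc j < n"
      then have "y j \<le> x (Suc j)" "x (Suc j) \<le> y (Suc j)"
        by (auto intro: 0)
      then show "y j \<le> y (Suc j)" by (rule order_trans)
    qed
    then show ?case by (simp add: v_def)
  next
    case (Suc k)
    then have k: "k < n" by simp
    obtain c where "\<forall>z. fdet n (\<lambda>i j. if j = k then z i else
        (if j < k then w j i else v j i (y j))) = (\<Sum>i<n. c i * z i)"
      using fdet_linear_col[OF k] by (rule exE)
    note c = this[rule_format]
    have pos_v: "0 < (\<Sum>i<n. c i * v k i t)" if "x k \<le> t" "t \<le> x (Suc k)" for t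
    proof -
      have "0 < fdet n (\<lambda>i j. if j < k then w j i else v j i ((y(k := t)) j))"
        using Suc.prems that by (intro Suc.IH) auto
      also have "\<dots> = fdet n (\<lambda>i j. if j = k then v k i t else
          (if j < k then w j i else v j i (y j)))"
        by (rule fdet_cong) simp
      finally show ?thesis by (simp only: c)
    qed
    define \<phi> where "\<phi> t = (\<Sum>i<n. c i * u (Suc k) (Suc i) t)" for t
    have "\<phi> (x k) \<le> \<phi> (x (Suc k))"
    proof (rule DERIV_nonneg_imp_nondecreasing[OF x[OF k]])
      fix t assume t: "x k \<le> t" "t \<le> x (Suc k)"
      have "(\<phi> has_real_derivative (\<Sum>i<n. c i * (r * v k i t))) (at t)"
        unfolding \<phi>_def v_def by (intro DERIV_sum DERIV_cmult der) simp
      moreover have "(\<Sum>i<n. c i * (r * v k i t)) = r * (\<Sum>i<n. c i * v k i t)"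
        by (simp add: sum_distrib_left mult_ac)
      ultimately show "\<exists>y. (\<phi> has_real_derivative y) (at t) \<and> 0 \<le> y"
        using pos_v[OF t] r by (metis less_imp_le mult_nonneg_nonneg)
    qed
    moreover have "0 < (\<Sum>i<n. c i * v k i (x k))"
      using x[OF k] by (intro pos_v) auto
    moreover have "(\<Sum>i<n. c i * w k i) = \<phi> (x (Suc k)) - \<phi> (x k) + (\<Sum>i<n. c i * v k i (x k))"
      by (simp add: \<phi>_def w_def v_def sum_subtractf sum.distrib[symmetric] algebra_simps)
    ultimately have "0 < (\<Sum>i<n. c i * w k i)" by linarith
    also have "\<dots> = fdet n (\<lambda>i j. if j = k then w k i else (if j < k then w j i else v j i (y j)))"
      by (simp only: c)
    also have "\<dots> = fdet n (\<lambda>i j. if j < Suc k then w j i else v j i (y j))"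
      by (rule fdet_cong) (simp add: less_Suc_eq)
    finally show ?case .
  qed
  have "0 < fdet n (\<lambda>i j. if j < n then w j i else v j i (x j))"
    using x by (intro mixed) auto
  also have "\<dots> = fdet n (\<lambda>i j. w j i)"
    by (rule fdet_cong) simp
  also have "\<dots> = fdet n (\<lambda>i j. u (Suc j) (Suc i) (x (Suc j)) +
      (if Suc j = 0 then 0 else - 1 * u (Suc j - 1) (Suc i) (x (Suc j - 1))))"
    by (simp add: w_def)
  also have "\<dots> = fdet (Suc n) (\<lambda>i j. u j i (x j) + (if j = 0 then 0 else - 1 * u (j - 1) i (x (j - 1))))"
    by (rule fdet_first_row_unit[symmetric]) (simp_all add: one)
  also have "\<dots> = fdet (Suc n) (\<lambda>i j. u j i (x j))"
    by (rule fdet_add_prev_col[of "Suc n" "\<lambda>i j. u j i (x j)" "\<lambda>_. - 1"])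
  finally show ?thesis .
qed

text \<open>
  Column factors turn the first row, which belongs to the largest rate, into ones.  The other rows
  then consist of \<open>u\<^sub>j(y) = (a\<^sub>0 / a\<^sub>i)\<^sup>j exp ((a\<^sub>0 - a\<^sub>i) y)\<close>, for which the difference
  \<open>u\<^sub>j\<^sub>+\<^sub>1 - u\<^sub>j = (a\<^sub>0 / a\<^sub>i - 1) u\<^sub>j\<close> is a positive multiple of \<open>u\<^sub>j\<close>.  Hence the smaller determinant is of
  the same kind, for the remaining rates.
\<close>

lemma fdet_exponential_pos:
  assumes "\<And>i. i < n \<Longrightarrow> 0 < a i"
    and "\<And>i. Suc i < n \<Longrightarrow> a (Suc i) < a i"
    and "\<And>j. Suc j < n \<Longrightarrow> x j \<le> x (Suc j)"
  shows "0 < fdet n (\<lambda>i j. exp (- a i * x j) / a i ^ j)"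
  using assms
proof (induction n arbitrary: a x)
  case (Suc n)
  define u where "u j i y = (a 0 / a i) ^ j * exp ((a 0 - a i) * y)" for j i y
  have a0: "0 < a 0" using Suc.prems(1) by simp
  have less: "a (Suc i) < a 0" if "i < n" for i
    using that
  proof (induction i)
    case (Suc m)
    then show ?case using \<open>\<And>i. Suc i < Suc n \<Longrightarrow> a (Suc i) < a i\<close>[of "Suc m"] by simp
  qed (use Suc.prems(2) in simp)
  have diff: "u (Suc j) (Suc i) y - u j (Suc i) y = (a 0 / a (Suc i) - 1) * u j (Suc i) y" for j i y
    by (simp add: u_def algebra_simps)
  have "0 < fdet (Suc n) (\<lambda>i j. u j i (x j))"
  proof (rule fdet_pos_of_differences[where r = "a 0"])
    fix j i y assume "i < n"
    then have "0 < a (Suc i)" using Suc.prems(1) by simp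
    then show "(u (Suc j) (Suc i) has_real_derivative a 0 * (u (Suc j) (Suc i) y - u j (Suc i) y)) (at y)"
      unfolding u_def
      by (auto intro!: derivative_eq_intros simp: field_simps)
  next
    fix y :: "nat \<Rightarrow> real" assume y: "\<And>j. Suc j < n \<Longrightarrow> y j \<le> y (Suc j)"
    have "0 < fdet n (\<lambda>i j. exp (- a (Suc i) * y j) / a (Suc i) ^ j)"
      using Suc.prems y by (intro Suc.IH) auto
    moreover have "0 < (\<Prod>j<n. a 0 ^ j * exp (a 0 * y j))"
      using a0 by (intro prod_pos) auto
    ultimately have "0 < fdet n (\<lambda>i j. (a 0 ^ j * exp (a 0 * y j)) * (exp (- a (Suc i) * y j) / a (Suc i) ^ j))"
      by (subst fdet_scale_cols) simp
    also have "\<dots> = fdet n (\<lambda>i j. u j (Suc i) (y j))"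
      by (rule fdet_cong) (simp add: u_def power_divide exp_add[symmetric] algebra_simps)
    finally have "0 < fdet n (\<lambda>i j. u j (Suc i) (y j))" .
    moreover have "0 < (\<Prod>i<n. a 0 / a (Suc i) - 1)"
      using less Suc.prems(1) by (intro prod_pos) (auto simp: field_simps)
    ultimately show "0 < fdet n (\<lambda>i j. u (Suc j) (Suc i) (y j) - u j (Suc i) (y j))"
      unfolding diff by (subst fdet_scale_rows) simp
  next
    show "u j 0 y = 1" for j y
      using less_imp_neq[OF a0] by (simp add: u_def)
  qed (use less_imp_le[OF a0] Suc.prems(3) in simp_all)
  moreover have "0 < (\<Prod>j<Suc n. exp (- a 0 * x j) / a 0 ^ j)"
    using a0 by (intro prod_pos) auto
  ultimately have "0 < fdet (Suc n) (\<lambda>i j. (exp (- a 0 * x j) / a 0 ^ j) * u j i (x j))"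
    unfolding fdet_scale_cols by (rule mult_pos_pos[rotated])
  also have "\<dots> = fdet (Suc n) (\<lambda>i j. exp (- a i * x j) / a i ^ j)"
    using a0 by (intro fdet_cong) (simp add: u_def power_divide exp_add[symmetric] algebra_simps)
  finally show ?case .
qed simp

section \<open>Moments of shifted Gamma variables\<close>

text \<open>
  For \<open>\<gamma>\<close> with law \<open>Gamma(j, l)\<close> this is \<open>E[(y + \<gamma>)\<^sup>i]\<close>, expanded by the binomial theorem; the
  moments are \<open>E[\<gamma>\<^sup>k] = j (j + 1) \<cdots> (j + k - 1) / l\<^sup>k\<close>.  The formula also covers \<open>j = 0\<close>, where
  \<open>\<gamma> = 0\<close> and only the term \<open>k = 0\<close> survives.
\<close>

definition gamma_moment :: "real \<Rightarrow> nat \<Rightarrow> nat \<Rightarrow> real \<Rightarrow> real" where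
  "gamma_moment l j i y =
     (\<Sum>k\<le>i. of_nat (i choose k) * (pochhammer (of_nat j) k / l ^ k) * y ^ (i - k))"

lemma gamma_moment_0 [simp]: "gamma_moment l j 0 y = 1"
  by (simp add: gamma_moment_def)

text \<open>
  These moments form an Appell sequence in \<open>i\<close>, as \<open>y\<close> enters only through \<open>(y + \<gamma>)\<^sup>i\<close>.
\<close>

lemma has_real_derivative_gamma_moment:
  "(gamma_moment l j (Suc i) has_real_derivative of_nat (Suc i) * gamma_moment l j i y) (at y)"
proof -
  let ?q = "\<lambda>k. pochhammer (of_nat j :: real) k / l ^ k"
  have "(gamma_moment l j (Suc i) has_real_derivative
      (\<Sum>k\<le>Suc i. of_nat (Suc i choose k) * ?q k * (of_nat (Suc i - k) * y ^ (Suc i - k - 1)))) (at y)"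
    unfolding gamma_moment_def[abs_def]
    by (intro DERIV_sum DERIV_cmult) (auto intro!: derivative_eq_intros)
  also have "(\<Sum>k\<le>Suc i. of_nat (Suc i choose k) * ?q k * (of_nat (Suc i - k) * y ^ (Suc i - k - 1)))
      = (\<Sum>k\<le>i. of_nat (Suc i choose k) * ?q k * (of_nat (Suc i - k) * y ^ (Suc i - k - 1)))"
    by simp
  also have "\<dots> = of_nat (Suc i) * gamma_moment l j i y"
    unfolding gamma_moment_def sum_distrib_left
  proof (rule sum.cong[OF refl])
    fix k assume "k \<in> {..i}"
    then have k: "k \<le> i" by simp
    have "(Suc i choose k) * (Suc i - k) = Suc i * (i choose k)"
      using binomial_absorb_comp[of "Suc i" k] by (simp add: mult.commute)
    then have "real (Suc i choose k) * real (Suc i - k) = real (Suc i) * real (i choose k)"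
      by (metis of_nat_mult)
    then show "real (Suc i choose k) * ?q k * (real (Suc i - k) * y ^ (Suc i - k - 1)) =
        real (Suc i) * (real (i choose k) * ?q k * y ^ (i - k))"
      by (simp del: binomial_Suc_Suc of_nat_Suc add: mult_ac)
  qed
  finally show ?thesis .
qed

text \<open>
  A \<open>Gamma(j + 1, l)\<close> variable is the sum of independent \<open>Gamma(j, l)\<close> and exponential variables.
  Integrating by parts in the exponential one shows that increasing the shape by one adds \<open>1 / l\<close>
  times the derivative of the new moment.  The proof compares coefficients instead.
\<close>

lemma gamma_moment_diff:
  "gamma_moment l (Suc j) (Suc i) y - gamma_moment l j (Suc i) y =
     of_nat (Suc i) / l * gamma_moment l (Suc j) i y"
proof -
  have poch: "pochhammer (real (Suc j)) (Suc k) - pochhammer (real j) (Suc k) =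
      real (Suc k) * pochhammer (real (Suc j)) k" for k
  proof -
    have "pochhammer (real (Suc j)) (Suc k) = pochhammer (real (Suc j)) k * (real (Suc j) + real k)"
      by (rule pochhammer_Suc)
    moreover have "pochhammer (real j) (Suc k) = real j * pochhammer (real (Suc j)) k"
      by (simp add: pochhammer_rec add.commute)
    ultimately show ?thesis by (simp add: algebra_simps)
  qed
  have "gamma_moment l (Suc j) (Suc i) y - gamma_moment l j (Suc i) y =
      (\<Sum>k\<le>Suc i. real (Suc i choose k) *
        ((pochhammer (real (Suc j)) k - pochhammer (real j) k) / l ^ k) * y ^ (Suc i - k))"
    unfolding gamma_moment_def sum_subtractf[symmetric]
    by (rule sum.cong) (simp_all add: diff_divide_distrib algebra_simps del: binomial_Suc_Suc)
  also have "\<dots> = (\<Sum>k\<le>i. real (Suc i choose Suc k) *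
        (real (Suc k) * pochhammer (real (Suc j)) k / l ^ Suc k) * y ^ (i - k))"
    by (subst sum.atMost_Suc_shift) (simp add: poch del: binomial_Suc_Suc of_nat_Suc power_Suc)
  also have "\<dots> = of_nat (Suc i) / l * gamma_moment l (Suc j) i y"
    unfolding gamma_moment_def sum_distrib_left
  proof (rule sum.cong[OF refl])
    fix k
    have "real (Suc i choose Suc k) * real (Suc k) = real (Suc i) * real (i choose k)"
      using Suc_times_binomial_eq[of i k] by (metis of_nat_mult)
    then show "real (Suc i choose Suc k) *
        (real (Suc k) * pochhammer (real (Suc j)) k / l ^ Suc k) * y ^ (i - k) =
        real (Suc i) / l * (real (i choose k) * (pochhammer (real (Suc j)) k / l ^ k) * y ^ (i - k))"
      by (simp del: binomial_Suc_Suc of_nat_Suc add: mult.assoc[symmetric])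
  qed
  finally show ?thesis .
qed

text \<open>
  By \<open>gamma_moment_diff\<close>, raising the shape parameter of a column is a unitriangular row operation
  that is the same for every column.
\<close>

lemma fdet_gamma_moment_Suc:
  "fdet n (\<lambda>i j. gamma_moment l (Suc (s j)) i (x j)) = fdet n (\<lambda>i j. gamma_moment l (s j) i (x j))"
proof -
  have "fdet n (\<lambda>i j. gamma_moment l (s j) i (x j)) =
      fdet n (\<lambda>i j. gamma_moment l (Suc (s j)) i (x j) +
        (if i = 0 then 0 else - (of_nat i / l) * gamma_moment l (Suc (s j)) (i - 1) (x j)))"
  proof (rule fdet_cong)
    fix i j
    show "gamma_moment l (s j) i (x j) = gamma_moment l (Suc (s j)) i (x j) +
        (if i = 0 then 0 else - (of_nat i / l) * gamma_moment l (Suc (s j)) (i - 1) (x j))"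
      using gamma_moment_diff[of l "s j" "i - 1" "x j"] by (cases i) auto
  qed
  also have "\<dots> = fdet n (\<lambda>i j. gamma_moment l (Suc (s j)) i (x j))"
    by (rule fdet_add_prev_row[of n _ "\<lambda>i. - (of_nat i / l)"])
  finally show ?thesis by (rule sym)
qed

text \<open>
  Taking adjacent differences raises the shape by one; the offset \<open>s\<close> keeps the statement inductive.
\<close>

lemma fdet_gamma_moment_pos:
  assumes l: "0 < l" and "\<And>j. Suc j < n \<Longrightarrow> x j \<le> x (Suc j)"
  shows "0 < fdet n (\<lambda>i j. gamma_moment l (s + j) i (x j))"
  using assms(2)
proof (induction n arbitrary: s x)
  case (Suc n)
  show ?case
  proof (rule fdet_pos_of_differences[where r = l and u = "\<lambda>j. gamma_moment l (s + j)"])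
    fix j i y
    show "(gamma_moment l (s + Suc j) (Suc i) has_real_derivative
        l * (gamma_moment l (s + Suc j) (Suc i) y - gamma_moment l (s + j) (Suc i) y)) (at y)"
      using has_real_derivative_gamma_moment[of l "s + Suc j" i y] l
      by (simp add: gamma_moment_diff)
  next
    fix y :: "nat \<Rightarrow> real" assume "\<And>j. Suc j < n \<Longrightarrow> y j \<le> y (Suc j)"
    then have "0 < fdet n (\<lambda>i j. gamma_moment l (Suc s + j) i (y j))"
      by (rule Suc.IH)
    moreover have "0 < (\<Prod>i<n. real (Suc i) / l)"
      using l by (intro prod_pos) auto
    ultimately show "0 < fdet n (\<lambda>i j. gamma_moment l (s + Suc j) (Suc i) (y j) -
        gamma_moment l (s + j) (Suc i) (y j))"
      by (simp only: add_Suc_right add_Suc gamma_moment_diff fdet_scale_rows mult_pos_pos)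
  qed (use l Suc.prems in auto)
qed simp

section \<open>Integrating the coordinates one by one\<close>

text \<open>
  What the two cases of the theorem have in common: up to a constant, \<open>h\<close> is
  \<open>exp (\<Sum> lam\<^sub>j y\<^sub>j)\<close> times a determinant whose column \<open>j\<close> is \<open>G\<^sub>j\<close> evaluated at coordinate \<open>j + 1\<close>, and
  \<open>G\<^sub>j\<^sub>+\<^sub>1(s)\<close> is the integral of \<open>G\<^sub>j\<close> over \<open>[s, \<infinity>)\<close>.  Nonnegativity on the chamber makes all
  integrals below integrals of nonnegative functions, which can be iterated freely.  The point \<open>x\<close> is the starting point of the walk.
\<close>

locale antiderivative_chain =
  fixes d :: nat
    and G :: "nat \<Rightarrow> nat \<Rightarrow> real \<Rightarrow> real"
    and lam :: "nat \<Rightarrow> real"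
    and x :: "nat \<Rightarrow> real"
  assumes deriv: "\<And>j i y. (G (Suc j) i has_real_derivative - G j i y) (at y)"
    and vanish: "\<And>j i. (G (Suc j) i \<longlongrightarrow> 0) at_top"
    and meas [measurable]: "\<And>j i. G j i \<in> borel_measurable borel"
    and nonneg: "\<And>y. (\<And>j. j \<in> {0<..<d} \<Longrightarrow> y j \<le> y (Suc j)) \<Longrightarrow>
      0 \<le> fdet d (\<lambda>i j. G j i (y (Suc j)))"
    and rate: "\<And>j. 0 < lam j"
    and start: "\<And>j. j \<in> {0<..<d} \<Longrightarrow> x j \<le> x (Suc j)"
begin

text \<open>
  The determinant after the coordinates \<open>1, \<dots>, k\<close> have been integrated out: each integration advances
  the index of one column by one and replaces its variable by the starting point.
\<close>

definition part_det :: "nat \<Rightarrow> (nat \<Rightarrow> real) \<Rightarrow> real" where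
  "part_det k y =
     fdet d (\<lambda>i j. if j < k then G (Suc j) i (x (Suc j)) else G j i (y (Suc j)))"

text \<open>
  The domain over which the remaining coordinates \<open>k + 1, \<dots>, d\<close> are integrated.
\<close>

definition tail_chamber :: "nat \<Rightarrow> (nat \<Rightarrow> real) set" where
  "tail_chamber k =
     {y. (\<forall>j\<in>{k<..d}. x j \<le> y j) \<and> (\<forall>j\<in>{k<..<d}. y j \<le> y (Suc j))}"

text \<open>
  An antiderivative, up to sign, of \<^const>\<open>part_det\<close> in coordinate \<open>k + 1\<close>: column \<open>k\<close> is replaced
  by \<open>G\<^sub>k\<^sub>+\<^sub>1(t)\<close>.
\<close>

definition slot_det :: "nat \<Rightarrow> (nat \<Rightarrow> real) \<Rightarrow> real \<Rightarrow> real" where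
  "slot_det k y t =
     fdet d (\<lambda>i j. if j = k then G (Suc k) i t else
       (if j < k then G (Suc j) i (x (Suc j)) else G j i (y (Suc j))))"

lemma slot_det_derivative:
  assumes "k < d"
  shows "(slot_det k y has_real_derivative - part_det k (y(Suc k := t))) (at t)"
proof -
  obtain c where "\<forall>z. fdet d (\<lambda>i j. if j = k then z i else
      (if j < k then G (Suc j) i (x (Suc j)) else G j i (y (Suc j)))) = (\<Sum>i<d. c i * z i)"
    using fdet_linear_col[OF assms] by (rule exE)
  note c = this[rule_format]
  have "part_det k (y(Suc k := t)) = fdet d (\<lambda>i j. if j = k then G k i t else
      (if j < k then G (Suc j) i (x (Suc j)) else G j i (y (Suc j))))"
    unfolding part_det_def by (rule fdet_cong) auto
  also have "\<dots> = (\<Sum>i<d. c i * G k i t)"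
    by (rule c)
  finally have *: "- part_det k (y(Suc k := t)) = (\<Sum>i<d. c i * - G k i t)"
    by (simp add: sum_negf)
  have "slot_det k y = (\<lambda>t. \<Sum>i<d. c i * G (Suc k) i t)"
    unfolding slot_det_def by (rule ext) (rule c)
  then show ?thesis
    unfolding * by (simp only:) (intro DERIV_sum DERIV_cmult deriv)
qed

lemma slot_det_start: "slot_det k y (x (Suc k)) = part_det (Suc k) y"
  unfolding slot_det_def part_det_def by (rule fdet_cong) (auto simp: less_Suc_eq)

text \<open>
  The key cancellation: at the upper end \<open>t = y\<^sub>k\<^sub>+\<^sub>2\<close> of the range of integration, column \<open>k\<close> agrees
  with column \<open>k + 1\<close>.
\<close>

lemma slot_det_next:
  assumes "Suc k < d"
  shows "slot_det k y (y (Suc (Suc k))) = 0"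
  unfolding slot_det_def by (rule fdet_eq_cols[of k d "Suc k"]) (use assms in auto)

lemma slot_det_vanish:
  assumes "k < d"
  shows "(slot_det k y \<longlongrightarrow> 0) at_top"
proof -
  obtain c where "\<forall>z. fdet d (\<lambda>i j. if j = k then z i else
      (if j < k then G (Suc j) i (x (Suc j)) else G j i (y (Suc j)))) = (\<Sum>i<d. c i * z i)"
    using fdet_linear_col[OF assms] by (rule exE)
  note c = this[rule_format]
  have "((\<lambda>t. \<Sum>i<d. c i * G (Suc k) i t) \<longlongrightarrow> (\<Sum>i<d. c i * 0)) at_top"
    by (intro tendsto_sum tendsto_mult tendsto_const vanish)
  then show ?thesis
    unfolding slot_det_def by (simp only: c) simp
qed

lemma update_mem_tail_chamber_iff:
  assumes "k < d"
  shows "y(Suc k := t) \<in> tail_chamber k \<longleftrightarrow>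
    y \<in> tail_chamber (Suc k) \<and> x (Suc k) \<le> t \<and> (Suc k < d \<longrightarrow> t \<le> y (Suc (Suc k)))"
proof -
  have "{k<..d} = insert (Suc k) {Suc k<..d}"
    using assms by auto
  moreover have "{k<..<d} = (if Suc k < d then insert (Suc k) {Suc k<..<d} else {Suc k<..<d})"
    using assms by auto
  ultimately show ?thesis
    unfolding tail_chamber_def by auto
qed

text \<open>
  The range \<open>[x\<^sub>k\<^sub>+\<^sub>1, y\<^sub>k\<^sub>+\<^sub>2]\<close> of integration is nonempty because the starting point lies in the chamber.
\<close>

lemma tail_chamber_start:
  assumes "Suc k < d" "y \<in> tail_chamber (Suc k)"
  shows "x (Suc k) \<le> y (Suc (Suc k))"
proof -
  have "x (Suc k) \<le> x (Suc (Suc k))"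
    using assms by (intro start) auto
  also have "\<dots> \<le> y (Suc (Suc k))"
    using assms by (auto simp: tail_chamber_def)
  finally show ?thesis .
qed

text \<open>
  A \<^const>\<open>part_det\<close> is an integral of the preceding one, which is nonnegative by induction.  In terms
  of the antiderivative: \<^const>\<open>slot_det\<close> does not increase, and vanishes at the upper end of the range.
\<close>

lemma part_det_nonneg:
  assumes "k \<le> d" "y \<in> tail_chamber k"
  shows "0 \<le> part_det k y"
  using assms
proof (induction k arbitrary: y)
  case 0
  have "0 \<le> fdet d (\<lambda>i j. G j i (y (Suc j)))"
    by (rule nonneg) (use 0 in \<open>simp add: tail_chamber_def\<close>)
  then show ?case by (simp add: part_det_def)
next
  case (Suc k)
  then have k: "k < d" by simp
  have anti: "slot_det k y s \<le> slot_det k y (x (Suc k))"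
    if s: "x (Suc k) \<le> s" "Suc k < d \<longrightarrow> s \<le> y (Suc (Suc k))" for s
  proof (rule DERIV_nonpos_imp_nonincreasing[OF s(1)])
    fix t assume t: "x (Suc k) \<le> t" "t \<le> s"
    have "y(Suc k := t) \<in> tail_chamber k"
      unfolding update_mem_tail_chamber_iff[OF k] using t s Suc.prems(2) by auto
    then have "0 \<le> part_det k (y(Suc k := t))"
      by (rule Suc.IH[rotated]) (use k in simp)
    then show "\<exists>D. (slot_det k y has_real_derivative D) (at t) \<and> D \<le> 0"
      using slot_det_derivative[OF k] by (intro exI[of _ "- part_det k (y(Suc k := t))"]) simp
  qed
  have "0 \<le> slot_det k y (x (Suc k))"
  proof (cases "Suc k < d")
    case True
    then show ?thesis
      using anti[of "y (Suc (Suc k))"] tail_chamber_start[OF True Suc.prems(2)] slot_det_next[OF True, of y]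
      by simp
  next
    case False
    show ?thesis
    proof (rule tendsto_upperbound[OF slot_det_vanish[OF k, of y]])
      show "\<forall>\<^sub>F s in at_top. slot_det k y s \<le> slot_det k y (x (Suc k))"
        using eventually_ge_at_top[of "x (Suc k)"] by eventually_elim (use anti False in simp)
    qed simp
  qed
  then show ?case by (simp add: slot_det_start)
qed

lemma part_det_measurable:
  assumes "\<And>j. j \<in> {k<..d} \<Longrightarrow> (\<lambda>\<omega>. y \<omega> j) \<in> borel_measurable N"
  shows "(\<lambda>\<omega>. part_det k (y \<omega>)) \<in> borel_measurable N"
proof -
  have "(\<lambda>\<omega>. if p i < k then G (Suc (p i)) i (x (Suc (p i))) else G (p i) i (y \<omega> (Suc (p i))))
      \<in> borel_measurable N" if "p permutes {0..<d}" "i \<in> {0..<d}" for p i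
  proof (cases "p i < k")
    case False
    have "p i < d"
      using permutes_in_image[OF that(1), of i] that(2) by auto
    with False have "(\<lambda>\<omega>. y \<omega> (Suc (p i))) \<in> borel_measurable N"
      by (intro assms) auto
    from measurable_compose[OF this meas] False show ?thesis by simp
  qed simp
  then show ?thesis
    unfolding part_det_def fdet_leibniz
    by (intro borel_measurable_sum borel_measurable_times borel_measurable_prod) auto
qed

lemma nn_integral_part_det:
  assumes k: "k < d"
  shows "(\<integral>\<^sup>+t. ennreal (part_det k (y(Suc k := t))) * indicator (tail_chamber k) (y(Suc k := t)) \<partial>lborel)
    = ennreal (part_det (Suc k) y) * indicator (tail_chamber (Suc k)) y"
proof (cases "y \<in> tail_chamber (Suc k)")
  case y: True
  have borel: "(\<lambda>t. part_det k (y(Suc k := t))) \<in> borel_measurable borel"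
    by (rule part_det_measurable) auto
  have deriv': "((\<lambda>t. - slot_det k y t) has_real_derivative part_det k (y(Suc k := t))) (at t)" for t
    using DERIV_minus[OF slot_det_derivative[OF k, of y t]] by simp
  have nonneg': "0 \<le> part_det k (y(Suc k := t))"
    if "x (Suc k) \<le> t" "Suc k < d \<longrightarrow> t \<le> y (Suc (Suc k))" for t
    using that y k by (intro part_det_nonneg) (auto simp: update_mem_tail_chamber_iff)
  show ?thesis
  proof (cases "Suc k < d")
    case True
    have "(\<integral>\<^sup>+t. ennreal (part_det k (y(Suc k := t))) * indicator (tail_chamber k) (y(Suc k := t)) \<partial>lborel)
        = (\<integral>\<^sup>+t. ennreal (part_det k (y(Suc k := t))) * indicator {x (Suc k)..y (Suc (Suc k))} t \<partial>lborel)"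
      using y k True by (intro nn_integral_cong) (simp add: indicator_def update_mem_tail_chamber_iff)
    also have "\<dots> = - slot_det k y (y (Suc (Suc k))) - - slot_det k y (x (Suc k))"
      by (rule nn_integral_FTC_Icc[OF borel deriv' nonneg' tail_chamber_start[OF True y]]) simp_all
    finally show ?thesis
      using y by (simp add: slot_det_next[OF True] slot_det_start)
  next
    case False
    have "((\<lambda>t. - slot_det k y t) \<longlongrightarrow> 0) at_top"
      using tendsto_minus[OF slot_det_vanish[OF k, of y]] by simp
    note FTC = nn_integral_FTC_atLeast[OF borel deriv' nonneg' this, of "x (Suc k)"]
    have "(\<integral>\<^sup>+t. ennreal (part_det k (y(Suc k := t))) * indicator (tail_chamber k) (y(Suc k := t)) \<partial>lborel)
        = (\<integral>\<^sup>+t. ennreal (part_det k (y(Suc k := t))) * indicator {x (Suc k)..} t \<partial>lborel)"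
      using y k False by (intro nn_integral_cong) (simp add: indicator_def update_mem_tail_chamber_iff)
    also have "\<dots> = 0 - - slot_det k y (x (Suc k))"
      by (rule FTC) (use False in simp_all)
    finally show ?thesis
      using y by (simp add: slot_det_start)
  qed
qed (use k in \<open>simp add: update_mem_tail_chamber_iff\<close>)

text \<open>
  The integrand for the increments under their exponential laws, as a function of the position \<open>y\<close>.
  For \<open>k = 0\<close> it is \<open>h\<close> up to a constant, restricted to the chamber and to positions above the start.
  Each increment that is integrated out contributes the factor \<open>lam\<^sub>j exp (lam\<^sub>j x\<^sub>j)\<close>, since
  \<open>lam\<^sub>j exp (- lam\<^sub>j (y\<^sub>j - x\<^sub>j)) exp (lam\<^sub>j y\<^sub>j)\<close> does not depend on \<open>y\<^sub>j\<close>.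
\<close>

definition weighted_det :: "nat \<Rightarrow> (nat \<Rightarrow> real) \<Rightarrow> ennreal" where
  "weighted_det k y =
     ennreal ((\<Prod>j\<in>{0<..k}. lam j * exp (lam j * x j)) * exp (\<Sum>j\<in>{k<..d}. lam j * y j) * part_det k y)
       * indicator (tail_chamber k) y"

lemma weighted_det_measurable:
  assumes y: "\<And>j. j \<in> {k<..d} \<Longrightarrow> (\<lambda>\<omega>. y \<omega> j) \<in> borel_measurable N"
  shows "(\<lambda>\<omega>. weighted_det k (y \<omega>)) \<in> borel_measurable N"
proof -
  note [measurable] = y part_det_measurable[of k y, OF y]
  have "Measurable.pred N (\<lambda>\<omega>. y \<omega> j \<le> y \<omega> (Suc j))" if "j \<in> {k<..<d}" for j
  proof -
    have [measurable]: "(\<lambda>\<omega>. y \<omega> j) \<in> borel_measurable N" "(\<lambda>\<omega>. y \<omega> (Suc j)) \<in> borel_measurable N"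
      using that by (auto intro: y)
    show ?thesis by measurable
  qed
  note [measurable] = this
  have [measurable]: "Measurable.pred N (\<lambda>\<omega>. y \<omega> \<in> tail_chamber k)"
    unfolding tail_chamber_def by simp measurable
  have "(\<lambda>\<omega>. indicator (tail_chamber k) (y \<omega>) :: ennreal) = indicator {\<omega>. y \<omega> \<in> tail_chamber k}"
    by (auto simp: indicator_def)
  then have [measurable]: "(\<lambda>\<omega>. indicator (tail_chamber k) (y \<omega>) :: ennreal) \<in> borel_measurable N"
    by simp
  show ?thesis
    unfolding weighted_det_def by measurable
qed

lemma nn_integral_weighted_det:
  assumes k: "k < d"
  shows "(\<integral>\<^sup>+t. weighted_det k (y(Suc k := x (Suc k) + t)) \<partial>density lborel (exponential_density (lam (Suc k))))
    = weighted_det (Suc k) y"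
proof -
  let ?l = "lam (Suc k)" and ?x = "x (Suc k)"
  let ?f = "\<lambda>s. ennreal (exponential_density ?l (s - ?x)) * weighted_det k (y(Suc k := s))"
  let ?W = "(\<Prod>j\<in>{0<..Suc k}. lam j * exp (lam j * x j)) * exp (\<Sum>j\<in>{Suc k<..d}. lam j * y j)"
  have W: "0 \<le> ?W"
    using rate by (intro mult_nonneg_nonneg prod_nonneg) (auto simp: less_imp_le)
  have [measurable]: "(\<lambda>s. weighted_det k (y(Suc k := s))) \<in> borel_measurable borel"
    by (rule weighted_det_measurable) auto
  have [measurable]: "(\<lambda>t. weighted_det k (y(Suc k := ?x + t))) \<in> borel_measurable borel"
    by (rule weighted_det_measurable) auto
  have "(\<integral>\<^sup>+t. weighted_det k (y(Suc k := ?x + t)) \<partial>density lborel (exponential_density ?l))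
      = (\<integral>\<^sup>+t. ?f (?x + 1 * t) \<partial>lborel)"
    by (subst nn_integral_density) auto
  also have "\<dots> = (\<integral>\<^sup>+s. ?f s \<partial>lborel)"
    by (subst nn_integral_real_affine[of ?f 1 ?x]) auto
  also have "\<dots> = (\<integral>\<^sup>+s. ennreal ?W * (ennreal (part_det k (y(Suc k := s))) *
      indicator (tail_chamber k) (y(Suc k := s))) \<partial>lborel)"
  proof (rule nn_integral_cong)
    fix s
    show "?f s = ennreal ?W * (ennreal (part_det k (y(Suc k := s))) *
      indicator (tail_chamber k) (y(Suc k := s)))"
    proof (cases "y(Suc k := s) \<in> tail_chamber k")
      case True
      then have s: "?x \<le> s"
        using k by (simp add: update_mem_tail_chamber_iff)
      have "{k<..d} = insert (Suc k) {Suc k<..d}"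
        using k by auto
      then have sum: "(\<Sum>j\<in>{k<..d}. lam j * (y(Suc k := s)) j) = ?l * s + (\<Sum>j\<in>{Suc k<..d}. lam j * y j)"
        by simp
      have "{0<..Suc k} = insert (Suc k) {0<..k}" by auto
      then have prod: "(\<Prod>j\<in>{0<..Suc k}. lam j * exp (lam j * x j)) =
          (?l * exp (?l * ?x)) * (\<Prod>j\<in>{0<..k}. lam j * exp (lam j * x j))"
        by simp
      have ex: "exponential_density ?l (s - ?x) * exp (?l * s) = ?l * exp (?l * ?x)"
        using s by (simp add: exponential_density_def mult_exp_exp algebra_simps)
      have dens: "0 \<le> exponential_density ?l (s - ?x)"
        using rate by (simp add: less_imp_le)
      define A where "A = (\<Prod>j\<in>{0<..k}. lam j * exp (lam j * x j))"
      define E where "E = exp (\<Sum>j\<in>{Suc k<..d}. lam j * y j)"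
      define P where "P = part_det k (y(Suc k := s))"
      have "exponential_density ?l (s - ?x) * (A * (exp (?l * s) * E) * P) =
          (exponential_density ?l (s - ?x) * exp (?l * s)) * A * E * P"
        by (simp only: mult_ac)
      also have "\<dots> = ?W * P"
        unfolding ex prod A_def E_def by (rule refl)
      finally have "ennreal (exponential_density ?l (s - ?x)) * ennreal (A * (exp (?l * s) * E) * P)
          = ennreal ?W * ennreal P"
        by (simp only: ennreal_mult'[OF dens, symmetric] ennreal_mult'[OF W, symmetric])
      then show ?thesis
        using True unfolding weighted_det_def sum exp_add A_def E_def P_def
        by (simp only: indicator_simps mult_1_right)
    qed (simp add: weighted_det_def)
  qed
  also have "\<dots> = ennreal ?W * (ennreal (part_det (Suc k) y) * indicator (tail_chamber (Suc k)) y)"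
  proof (subst nn_integral_cmult)
    have [measurable]: "(\<lambda>s. part_det k (y(Suc k := s))) \<in> borel_measurable borel"
      by (rule part_det_measurable) auto
    have "{s. y(Suc k := s) \<in> tail_chamber k} =
        (if y \<in> tail_chamber (Suc k)
         then (if Suc k < d then {?x..y (Suc (Suc k))} else {?x..}) else {})"
      using k by (auto simp: update_mem_tail_chamber_iff)
    then have "{s. y(Suc k := s) \<in> tail_chamber k} \<in> sets borel"
      by simp
    moreover have "(\<lambda>s. indicator (tail_chamber k) (y(Suc k := s)) :: ennreal) =
        indicator {s. y(Suc k := s) \<in> tail_chamber k}"
      by (auto simp: indicator_def)
    ultimately have [measurable]: "(\<lambda>s. indicator (tail_chamber k) (y(Suc k := s)) :: ennreal) \<in> borel_measurable borel"
      by simp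
    show "(\<lambda>s. ennreal (part_det k (y(Suc k := s))) * indicator (tail_chamber k) (y(Suc k := s)))
        \<in> borel_measurable lborel"
      by measurable
  qed (simp only: nn_integral_part_det[OF k])
  also have "\<dots> = weighted_det (Suc k) y"
    using W by (simp add: weighted_det_def ennreal_mult'[symmetric] mult.assoc[symmetric])
  finally show ?thesis .
qed

theorem nn_integral_product_exponential:
  "(\<integral>\<^sup>+\<xi>. weighted_det 0 (\<lambda>j. x j + \<xi> j) \<partial>(\<Pi>\<^sub>M j\<in>{0<..d}. density lborel (exponential_density (lam j))))
    = ennreal ((\<Prod>j\<in>{0<..d}. lam j * exp (lam j * x j)) * fdet d (\<lambda>i j. G (Suc j) i (x (Suc j))))"
proof -
  define \<nu> where "\<nu> = (\<lambda>j. density lborel (exponential_density (lam j)))"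
  have "prob_space (\<nu> j)" for j
    unfolding \<nu>_def by (rule prob_space_exponential_density[OF rate])
  then interpret product_sigma_finite \<nu>
    by (simp add: product_sigma_finite_def prob_space_imp_sigma_finite)
  have sets_\<nu> [measurable_cong]: "sets (\<nu> j) = sets borel" for j
    by (simp add: \<nu>_def)
  have "(\<integral>\<^sup>+\<xi>. weighted_det 0 (\<lambda>j. x j + \<xi> j) \<partial>Pi\<^sub>M {0<..d} \<nu>) =
      (\<integral>\<^sup>+\<xi>. weighted_det k (\<lambda>j. x j + \<xi> j) \<partial>Pi\<^sub>M {k<..d} \<nu>)" if "k \<le> d" for k
    using that
  proof (induction k)
    case (Suc k)
    then have k: "k < d" by simp
    then have split: "{k<..d} = insert (Suc k) {Suc k<..d}" by auto
    have "(\<lambda>\<xi>. weighted_det k (\<lambda>j. x j + \<xi> j)) \<in> borel_measurable (Pi\<^sub>M {k<..d} \<nu>)"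
      by (rule weighted_det_measurable) measurable
    then have "(\<integral>\<^sup>+\<xi>. weighted_det k (\<lambda>j. x j + \<xi> j) \<partial>Pi\<^sub>M {k<..d} \<nu>) =
        (\<integral>\<^sup>+\<xi>. (\<integral>\<^sup>+t. weighted_det k (\<lambda>j. x j + (\<xi>(Suc k := t)) j) \<partial>\<nu> (Suc k)) \<partial>Pi\<^sub>M {Suc k<..d} \<nu>)"
      unfolding split by (intro product_nn_integral_insert) auto
    also have "\<dots> = (\<integral>\<^sup>+\<xi>. weighted_det (Suc k) (\<lambda>j. x j + \<xi> j) \<partial>Pi\<^sub>M {Suc k<..d} \<nu>)"
    proof (rule nn_integral_cong)
      fix \<xi>
      have "(\<lambda>j. x j + (\<xi>(Suc k := t)) j) = (\<lambda>j. x j + \<xi> j)(Suc k := x (Suc k) + t)" for t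
        by auto
      then show "(\<integral>\<^sup>+t. weighted_det k (\<lambda>j. x j + (\<xi>(Suc k := t)) j) \<partial>\<nu> (Suc k)) =
          weighted_det (Suc k) (\<lambda>j. x j + \<xi> j)"
        unfolding \<nu>_def by (simp only: nn_integral_weighted_det[OF k])
    qed
    finally show ?case
      using Suc.IH k by simp
  qed simp
  from this[of d] have "(\<integral>\<^sup>+\<xi>. weighted_det 0 (\<lambda>j. x j + \<xi> j) \<partial>Pi\<^sub>M {0<..d} \<nu>) =
      weighted_det d (\<lambda>j. x j + undefined)"
    by (simp add: nn_integral_empty)
  also have "\<dots> = ennreal ((\<Prod>j\<in>{0<..d}. lam j * exp (lam j * x j)) * part_det d (\<lambda>j. x j + undefined))"
    by (simp add: weighted_det_def tail_chamber_def)
  also have "part_det d (\<lambda>j. x j + undefined) = fdet d (\<lambda>i j. G (Suc j) i (x (Suc j)))"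
    unfolding part_det_def by (rule fdet_cong) simp
  finally show ?thesis
    unfolding \<nu>_def .
qed

lemma weighted_det_cong:
  assumes "\<And>j. j \<in> {k<..d} \<Longrightarrow> y j = z j"
  shows "weighted_det k y = weighted_det k z"
proof -
  have "part_det k y = part_det k z"
    unfolding part_det_def by (rule fdet_cong) (use assms in auto)
  moreover have "y \<in> tail_chamber k \<longleftrightarrow> z \<in> tail_chamber k"
    using assms by (simp add: tail_chamber_def)
  moreover have "(\<Sum>j\<in>{k<..d}. lam j * y j) = (\<Sum>j\<in>{k<..d}. lam j * z j)"
    by (rule sum.cong) (use assms in auto)
  ultimately show ?thesis
    by (simp add: weighted_det_def indicator_def)
qed

end

section \<open>One step of the walk\<close>

lemma weyl_chamber_iff:
  "y \<in> weyl_chamber d \<longleftrightarrow> (\<forall>j\<in>{0<..<d}. y j \<le> y (Suc j))"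
proof
  assume y: "\<forall>j\<in>{0<..<d}. y j \<le> y (Suc j)"
  have "y i \<le> y j" if "i \<le> j" "0 < i" "j \<le> d" for i j
    using that
  proof (induction j rule: dec_induct)
    case (step j)
    then have "y i \<le> y j" by simp
    also have "y j \<le> y (Suc j)" using y step by simp
    finally show ?case .
  qed simp
  then show "y \<in> weyl_chamber d"
    by (simp add: weyl_chamber_def)
qed (simp add: weyl_chamber_def)

lemma exit_time_gt_1_iff: "1 < exit_time d X x \<omega> \<longleftrightarrow> walk X x 1 \<omega> \<in> weyl_chamber d"
proof
  assume gt: "1 < exit_time d X x \<omega>"
  show "walk X x 1 \<omega> \<in> weyl_chamber d"
  proof (rule ccontr)
    assume "walk X x 1 \<omega> \<notin> weyl_chamber d"
    then have "exit_time d X x \<omega> \<le> enat 1"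
      unfolding exit_time_def by (intro INF_lower) simp
    with gt show False by (simp add: one_enat_def)
  qed
next
  assume stay: "walk X x 1 \<omega> \<in> weyl_chamber d"
  have "enat 2 \<le> exit_time d X x \<omega>"
    unfolding exit_time_def
  proof (rule INF_greatest)
    fix n assume n: "n \<in> {n. 1 \<le> n \<and> walk X x n \<omega> \<notin> weyl_chamber d}"
    with stay have "n \<noteq> 1" by auto
    with n show "enat 2 \<le> enat n" by simp
  qed
  moreover have "(1 :: enat) < enat 2" by (simp add: one_enat_def)
  ultimately show "1 < exit_time d X x \<omega>" by (rule less_le_trans[rotated])
qed

lemma (in prob_space) indep_vars_reindex:
  assumes f: "inj_on f I" and indep: "indep_vars M' X (f ` I)"
  shows "indep_vars (\<lambda>i. M' (f i)) (\<lambda>i. X (f i)) I"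
  unfolding indep_vars_def2
proof (intro conjI ballI)
  show "random_variable (M' (f i)) (X (f i))" if "i \<in> I" for i
    using indep that by (auto simp: indep_vars_def2)
  let ?F = "\<lambda>i. {X i -` A \<inter> space M |A. A \<in> sets (M' i)}"
  have sets: "indep_sets ?F (f ` I)"
    using indep by (simp add: indep_vars_def2)
  show "indep_sets (\<lambda>i. ?F (f i)) I"
    unfolding indep_sets_def
  proof (intro conjI allI impI ballI)
    show "?F (f i) \<subseteq> events" if "i \<in> I" for i
      using sets that unfolding indep_sets_def by blast
  next
    fix J A assume J: "J \<subseteq> I" "J \<noteq> {}" "finite J" and A: "A \<in> Pi J (\<lambda>i. ?F (f i))"
    define g where "g = the_inv_into I f"
    have g: "g (f i) = i" if "i \<in> J" for i
      using J f that by (auto simp: g_def the_inv_into_f_f)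
    have "prob (\<Inter>k\<in>f ` J. A (g k)) = (\<Prod>k\<in>f ` J. prob (A (g k)))"
    proof (rule indep_setsD[OF sets])
      show "\<forall>k\<in>f ` J. A (g k) \<in> ?F k"
        using A g by (simp add: Pi_iff)
    qed (use J in auto)
    moreover have "(\<Inter>k\<in>f ` J. A (g k)) = (\<Inter>i\<in>J. A i)"
      using g by auto
    moreover have "(\<Prod>k\<in>f ` J. prob (A (g k))) = (\<Prod>i\<in>J. prob (A i))"
      using g inj_on_subset[OF f J(1)] by (simp add: prod.reindex)
    ultimately show "prob (\<Inter>i\<in>J. A i) = (\<Prod>i\<in>J. prob (A i))"
      by simp
  qed
qed

text \<open>
  The product integral above is the expectation of one step, once the increments are known to be
  almost surely nonnegative.  What it yields is the determinant with all columns advanced by one;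
  the hypothesis \<open>eigen\<close> says that this is the original determinant divided by the product of the
  rates.
\<close>

theorem (in antiderivative_chain) expectation_killed_walk:
  assumes "prob_space M"
    and d: "0 < d"
    and indep: "prob_space.indep_vars M (\<lambda>_. borel) (\<lambda>(i, j). X i j) ({1..} \<times> {1..d})"
    and dist: "\<And>j. j \<in> {0<..d} \<Longrightarrow> distributed M lborel (X 1 j) (exponential_density (lam j))"
    and h: "\<And>y. h y = C * (exp (\<Sum>j\<in>{0<..d}. lam j * y j) * fdet d (\<lambda>i j. G j i (y (Suc j))))"
    and eigen: "(\<Prod>j\<in>{0<..d}. lam j) * fdet d (\<lambda>i j. G (Suc j) i (x (Suc j))) =
      fdet d (\<lambda>i j. G j i (x (Suc j)))"
  shows "prob_space.expectation M
      (\<lambda>\<omega>. h (walk X x 1 \<omega>) * indicator {\<omega>. exit_time d X x \<omega> > 1} \<omega>) = h x"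
proof -
  interpret prob_space M by fact
  let ?Y = "\<lambda>\<omega> j. x j + X 1 j \<omega>"
  let ?f = "\<lambda>\<omega>. exp (\<Sum>j\<in>{0<..d}. lam j * ?Y \<omega> j) * part_det 0 (?Y \<omega>)
    * indicator {\<omega>. ?Y \<omega> \<in> weyl_chamber d} \<omega>"
  have X [measurable]: "X 1 j \<in> borel_measurable M" if "j \<in> {0<..d}" for j
    using distributed_measurable[OF dist[OF that]] by simp
  have Y: "(\<lambda>\<omega>. ?Y \<omega> j) \<in> borel_measurable M" if "j \<in> {0<..d}" for j
    using X[OF that] by simp
  have walk: "walk X x 1 \<omega> = ?Y \<omega>" for \<omega>
    by (simp add: walk_def)
  have hf: "h (walk X x 1 \<omega>) * indicator {\<omega>. exit_time d X x \<omega> > 1} \<omega> = C * ?f \<omega>" for \<omega>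
    unfolding exit_time_gt_1_iff walk h part_det_def by simp

  have meas_f: "?f \<in> borel_measurable M"
  proof -
    note [measurable] = Y part_det_measurable[of 0 ?Y, OF Y]
    have "Measurable.pred M (\<lambda>\<omega>. ?Y \<omega> j \<le> ?Y \<omega> (Suc j))" if "j \<in> {0<..<d}" for j
    proof -
      have [measurable]: "(\<lambda>\<omega>. ?Y \<omega> j) \<in> borel_measurable M" "(\<lambda>\<omega>. ?Y \<omega> (Suc j)) \<in> borel_measurable M"
        by (rule Y; use that in simp)+
      show ?thesis by measurable
    qed
    note [measurable] = this
    have [measurable]: "Measurable.pred M (\<lambda>\<omega>. ?Y \<omega> \<in> weyl_chamber d)"
      unfolding weyl_chamber_iff by measurable
    show ?thesis by measurable
  qed
  \<comment> \<open>Since the increments are nonnegative, staying in the chamber puts the position in the domain of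
    integration \<open>tail_chamber 0\<close>.\<close>
  have "AE \<omega> in M. 0 \<le> X 1 j \<omega>" if "j \<in> {0<..d}" for j
    by (subst distributed_AE2[OF dist[OF that]]) (auto simp: exponential_density_def)
  then have "AE \<omega> in M. \<forall>j\<in>{0<..d}. 0 \<le> X 1 j \<omega>"
    by (simp add: AE_finite_all)
  then have AE_f: "AE \<omega> in M. ennreal (?f \<omega>) = weighted_det 0 (?Y \<omega>) \<and> 0 \<le> ?f \<omega>"
  proof eventually_elim
    case (elim \<omega>)
    then have "?Y \<omega> \<in> weyl_chamber d \<longleftrightarrow> ?Y \<omega> \<in> tail_chamber 0"
      by (simp add: weyl_chamber_iff tail_chamber_def)
    then show ?case
      using part_det_nonneg[of 0 "?Y \<omega>"] by (simp add: weighted_det_def indicator_def)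
  qed

  have "indep_vars (\<lambda>_. borel) (\<lambda>(i, j). X i j) (Pair 1 ` {0<..d})"
    by (rule indep_vars_subset[OF indep]) auto
  from indep_vars_reindex[OF _ this] have "indep_vars (\<lambda>_. borel) (X 1) {0<..d}"
    by (simp add: inj_on_def)
  then have "distr M (\<Pi>\<^sub>M j\<in>{0<..d}. borel) (\<lambda>\<omega>. \<lambda>j\<in>{0<..d}. X 1 j \<omega>) =
      (\<Pi>\<^sub>M j\<in>{0<..d}. distr M borel (X 1 j))"
    using d X by (subst (asm) indep_vars_iff_distr_eq_PiM') auto
  also have "\<dots> = (\<Pi>\<^sub>M j\<in>{0<..d}. density lborel (exponential_density (lam j)))"
  proof (rule PiM_cong[OF refl])
    fix j assume "j \<in> {0<..d}"
    from distributed_distr_eq_density[OF dist[OF this]]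
    show "distr M borel (X 1 j) = density lborel (exponential_density (lam j))"
      by (simp cong: distr_cong)
  qed
  finally have law: "(\<Pi>\<^sub>M j\<in>{0<..d}. density lborel (exponential_density (lam j))) =
      distr M (\<Pi>\<^sub>M j\<in>{0<..d}. borel) (\<lambda>\<omega>. \<lambda>j\<in>{0<..d}. X 1 j \<omega>)"
    by (rule sym)

  have "(\<integral>\<^sup>+\<omega>. ennreal (?f \<omega>) \<partial>M) = (\<integral>\<^sup>+\<omega>. weighted_det 0 (?Y \<omega>) \<partial>M)"
    by (rule nn_integral_cong_AE) (use AE_f in auto)
  also have "\<dots> = (\<integral>\<^sup>+\<omega>. weighted_det 0 (\<lambda>j. x j + (\<lambda>j\<in>{0<..d}. X 1 j \<omega>) j) \<partial>M)"
    by (intro nn_integral_cong weighted_det_cong) simp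
  also have "\<dots> = (\<integral>\<^sup>+\<xi>. weighted_det 0 (\<lambda>j. x j + \<xi> j)
      \<partial>(\<Pi>\<^sub>M j\<in>{0<..d}. density lborel (exponential_density (lam j))))"
  proof -
    have T: "(\<lambda>\<omega>. \<lambda>j\<in>{0<..d}. X 1 j \<omega>) \<in> measurable M (\<Pi>\<^sub>M j\<in>{0<..d}. borel)"
      by (intro measurable_restrict X)
    have f: "(\<lambda>\<xi>. weighted_det 0 (\<lambda>j. x j + \<xi> j)) \<in> borel_measurable (\<Pi>\<^sub>M j\<in>{0<..d}. borel)"
      by (rule weighted_det_measurable) measurable
    show ?thesis
      unfolding law by (subst nn_integral_distr[OF T]) (use f in simp_all)
  qed
  also have "\<dots> = ennreal ((\<Prod>j\<in>{0<..d}. lam j * exp (lam j * x j)) * fdet d (\<lambda>i j. G (Suc j) i (x (Suc j))))"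
    by (rule nn_integral_product_exponential)
  also have "(\<Prod>j\<in>{0<..d}. lam j * exp (lam j * x j)) * fdet d (\<lambda>i j. G (Suc j) i (x (Suc j))) =
      exp (\<Sum>j\<in>{0<..d}. lam j * x j) * fdet d (\<lambda>i j. G j i (x (Suc j)))"
    by (simp add: eigen[symmetric] prod.distrib exp_sum)
  finally have "(\<integral>\<^sup>+\<omega>. ennreal (?f \<omega>) \<partial>M) =
      ennreal (exp (\<Sum>j\<in>{0<..d}. lam j * x j) * fdet d (\<lambda>i j. G j i (x (Suc j))))" .
  moreover have "0 \<le> fdet d (\<lambda>i j. G j i (x (Suc j)))"
    using start by (intro nonneg)
  ultimately have "expectation ?f = exp (\<Sum>j\<in>{0<..d}. lam j * x j) * fdet d (\<lambda>i j. G j i (x (Suc j)))"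
    using AE_f by (subst integral_eq_nn_integral[OF meas_f]) auto
  then show ?thesis
    unfolding hf by (simp add: h[of x])
qed

section \<open>The two determinants\<close>

text \<open>
  Distinct rates: the functions are exponentials, so advancing all columns by one divides row \<open>i\<close> by
  its own rate.
\<close>

lemma antiderivative_chain_exponential:
  assumes lam: "\<And>j. 0 < lam j"
    and dec: "\<forall>i\<in>{0<..<d}. lam (Suc i) < lam i"
    and x: "x \<in> weyl_chamber d"
  defines "G \<equiv> \<lambda>j i y. lam (Suc i) powi (int i - int j) * exp (- lam (Suc i) * y)"
  shows "antiderivative_chain d G lam x"
    and "y \<in> weyl_chamber d \<Longrightarrow> 0 < fdet d (\<lambda>i j. G j i (y (Suc j)))"
    and "(\<Prod>j\<in>{0<..d}. lam j) * fdet d (\<lambda>i j. G (Suc j) i (y (Suc j))) =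
      fdet d (\<lambda>i j. G j i (y (Suc j)))"
proof -
  have shift: "lam (Suc i) * lam (Suc i) powi (int i - int (Suc j)) = lam (Suc i) powi (int i - int j)" for i j
  proof -
    have "lam (Suc i) powi (int i - int j) = lam (Suc i) powi (1 + (int i - int (Suc j)))"
      by simp
    also have "\<dots> = lam (Suc i) * lam (Suc i) powi (int i - int (Suc j))"
      using lam[of "Suc i"] by (subst power_int_add) auto
    finally show ?thesis by (rule sym)
  qed
  have pos: "0 < fdet d (\<lambda>i j. G j i (y (Suc j)))" if y: "y \<in> weyl_chamber d" for y
  proof -
    have "0 < fdet d (\<lambda>i j. exp (- lam (Suc i) * y (Suc j)) / lam (Suc i) ^ j)"
      using lam dec y by (intro fdet_exponential_pos) (auto simp: weyl_chamber_iff)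
    moreover have "0 < (\<Prod>i<d. lam (Suc i) ^ i)"
      using lam by (intro prod_pos) auto
    ultimately have "0 < (\<Prod>i<d. lam (Suc i) ^ i) *
        fdet d (\<lambda>i j. exp (- lam (Suc i) * y (Suc j)) / lam (Suc i) ^ j)"
      by (rule mult_pos_pos[rotated])
    also have "\<dots> = fdet d (\<lambda>i j. lam (Suc i) ^ i * (exp (- lam (Suc i) * y (Suc j)) / lam (Suc i) ^ j))"
      by (rule fdet_scale_rows[symmetric])
    also have "\<dots> = fdet d (\<lambda>i j. G j i (y (Suc j)))"
    proof (rule fdet_cong)
      fix i j
      have "lam (Suc i) powi (int i - int j) = lam (Suc i) ^ i / lam (Suc i) ^ j"
        using lam[of "Suc i"] by (simp add: power_int_diff)
      then show "lam (Suc i) ^ i * (exp (- lam (Suc i) * y (Suc j)) / lam (Suc i) ^ j) = G j i (y (Suc j))"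
        by (simp add: G_def)
    qed
    finally show ?thesis .
  qed
  show "y \<in> weyl_chamber d \<Longrightarrow> 0 < fdet d (\<lambda>i j. G j i (y (Suc j)))"
    by (rule pos)
  show "antiderivative_chain d G lam x"
  proof
    fix j i y
    have "(G (Suc j) i has_real_derivative
        - (lam (Suc i) * lam (Suc i) powi (int i - int (Suc j))) * exp (- lam (Suc i) * y)) (at y)"
      unfolding G_def by (auto intro!: derivative_eq_intros)
    then show "(G (Suc j) i has_real_derivative - G j i y) (at y)"
      unfolding shift by (simp add: G_def)
  next
    fix j i
    have "((\<lambda>y. exp (- lam (Suc i) * y)) \<longlongrightarrow> 0) at_top"
      using lam[of "Suc i"] by real_asymp
    then show "(G (Suc j) i \<longlongrightarrow> 0) at_top"
      unfolding G_def by (rule tendsto_mult_right_zero)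
  next
    fix j i
    show "G j i \<in> borel_measurable borel"
      unfolding G_def by measurable
  next
    fix y :: "nat \<Rightarrow> real" assume "\<And>j. j \<in> {0<..<d} \<Longrightarrow> y j \<le> y (Suc j)"
    then show "0 \<le> fdet d (\<lambda>i j. G j i (y (Suc j)))"
      by (intro less_imp_le pos) (simp add: weyl_chamber_iff)
  qed (use lam x in \<open>auto simp: weyl_chamber_iff\<close>)
  have "(\<Prod>j\<in>{0<..d}. lam j) = (\<Prod>i<d. lam (Suc i))"
    using prod.atLeast1_atMost_eq[of lam d] by (simp add: atLeastSucAtMost_greaterThanAtMost)
  then have "(\<Prod>j\<in>{0<..d}. lam j) * fdet d (\<lambda>i j. G (Suc j) i (y (Suc j))) =
      fdet d (\<lambda>i j. lam (Suc i) * G (Suc j) i (y (Suc j)))"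
    by (simp add: fdet_scale_rows)
  also have "\<dots> = fdet d (\<lambda>i j. G j i (y (Suc j)))"
    by (rule fdet_cong) (simp only: G_def mult.assoc[symmetric] shift)
  finally show "(\<Prod>j\<in>{0<..d}. lam j) * fdet d (\<lambda>i j. G (Suc j) i (y (Suc j))) =
      fdet d (\<lambda>i j. G j i (y (Suc j)))" .
qed

text \<open>
  Equal rates: the exponential factor in \<open>G\<close> contributes \<open>exp (- \<Sum> l y\<^sub>j)\<close> to the determinant,
  which cancels the weight and leaves the polynomial determinant.  Advancing all columns by one raises
  every shape by one, which does not change the polynomial determinant, and contributes the factor
  \<open>1 / l\<close> in each column.
\<close>

lemma antiderivative_chain_gamma:
  assumes l: "0 < l" and x: "x \<in> weyl_chamber d"
  defines "G \<equiv> \<lambda>j i y. (1 / l) ^ j * exp (- l * y) * gamma_moment l j i y"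
  shows "antiderivative_chain d G (\<lambda>_. l) x"
    and "fdet d (\<lambda>i j. gamma_moment l j i (y (Suc j))) =
      (\<Prod>j<d. l ^ j) * (exp (\<Sum>j\<in>{0<..d}. l * y j) * fdet d (\<lambda>i j. G j i (y (Suc j))))"
    and "y \<in> weyl_chamber d \<Longrightarrow> 0 < fdet d (\<lambda>i j. gamma_moment l j i (y (Suc j)))"
    and "(\<Prod>j\<in>{0<..d}. l) * fdet d (\<lambda>i j. G (Suc j) i (y (Suc j))) =
      fdet d (\<lambda>i j. G j i (y (Suc j)))"
proof -
  have pos: "0 < fdet d (\<lambda>i j. gamma_moment l j i (y (Suc j)))" if "y \<in> weyl_chamber d" for y
    using fdet_gamma_moment_pos[OF l, of d "\<lambda>j. y (Suc j)" 0] that by (simp add: weyl_chamber_iff)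
  have G: "fdet d (\<lambda>i j. G j i (y (Suc j))) =
      (\<Prod>j<d. (1 / l) ^ j * exp (- l * y (Suc j))) * fdet d (\<lambda>i j. gamma_moment l j i (y (Suc j)))" for y
    unfolding G_def by (rule fdet_scale_cols)
  show "y \<in> weyl_chamber d \<Longrightarrow> 0 < fdet d (\<lambda>i j. gamma_moment l j i (y (Suc j)))"
    by (rule pos)
  show "antiderivative_chain d G (\<lambda>_. l) x"
  proof
    fix j i y
    have "(gamma_moment l (Suc j) i has_real_derivative
        l * (gamma_moment l (Suc j) i y - gamma_moment l j i y)) (at y)"
    proof (cases i)
      case 0
      have "gamma_moment l (Suc j) 0 = (\<lambda>_. 1)" by (rule ext) simp
      then show ?thesis using 0 by simp
    next
      case (Suc m)
      then show ?thesis
        using has_real_derivative_gamma_moment[of l "Suc j" m y] l by (simp add: gamma_moment_diff)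
    qed
    then show "(G (Suc j) i has_real_derivative - G j i y) (at y)"
      unfolding G_def using l
      by (auto intro!: derivative_eq_intros simp: field_simps)
  next
    fix j i
    have "((\<lambda>y. y ^ m * exp (- l * y)) \<longlongrightarrow> 0) at_top" for m :: nat
      using l by real_asymp
    then have "((\<lambda>y. (1 / l) ^ Suc j * (\<Sum>k\<le>i. of_nat (i choose k) * (pochhammer (of_nat (Suc j)) k / l ^ k) *
        (y ^ (i - k) * exp (- l * y)))) \<longlongrightarrow> (1 / l) ^ Suc j * (\<Sum>k\<le>i. of_nat (i choose k) * (pochhammer (of_nat (Suc j)) k / l ^ k) * 0)) at_top"
      by (intro tendsto_mult tendsto_const tendsto_sum)
    then show "(G (Suc j) i \<longlongrightarrow> 0) at_top"
      by (simp add: G_def gamma_moment_def sum_distrib_left mult_ac)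
  next
    fix j i
    show "G j i \<in> borel_measurable borel"
      unfolding G_def gamma_moment_def by measurable
  next
    fix y :: "nat \<Rightarrow> real" assume "\<And>j. j \<in> {0<..<d} \<Longrightarrow> y j \<le> y (Suc j)"
    then have "y \<in> weyl_chamber d" by (simp add: weyl_chamber_iff)
    from pos[OF this] show "0 \<le> fdet d (\<lambda>i j. G j i (y (Suc j)))"
      unfolding G using l by (intro mult_nonneg_nonneg prod_nonneg) auto
  qed (use l x in \<open>auto simp: weyl_chamber_iff\<close>)
  have "exp (\<Sum>j\<in>{0<..d}. l * y j) = (\<Prod>j<d. exp (l * y (Suc j)))"
    using sum.atLeast1_atMost_eq[of "\<lambda>j. l * y j" d]
    by (simp add: atLeastSucAtMost_greaterThanAtMost exp_sum)
  then have "(\<Prod>j<d. l ^ j) * (exp (\<Sum>j\<in>{0<..d}. l * y j) * fdet d (\<lambda>i j. G j i (y (Suc j)))) =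
      (\<Prod>j<d. l ^ j * (exp (l * y (Suc j)) * ((1 / l) ^ j * exp (- l * y (Suc j))))) *
        fdet d (\<lambda>i j. gamma_moment l j i (y (Suc j)))"
    unfolding G by (simp only: prod.distrib mult.assoc)
  also have "(\<Prod>j<d. l ^ j * (exp (l * y (Suc j)) * ((1 / l) ^ j * exp (- l * y (Suc j))))) = 1"
    using l by (intro prod.neutral) (simp add: exp_minus field_simps)
  finally show "fdet d (\<lambda>i j. gamma_moment l j i (y (Suc j))) =
      (\<Prod>j<d. l ^ j) * (exp (\<Sum>j\<in>{0<..d}. l * y j) * fdet d (\<lambda>i j. G j i (y (Suc j))))"
    by simp
  have "(\<Prod>j\<in>{0<..d}. l) * fdet d (\<lambda>i j. G (Suc j) i (y (Suc j))) =
      fdet d (\<lambda>i j. l * ((1 / l) ^ Suc j * exp (- l * y (Suc j)) * gamma_moment l (Suc j) i (y (Suc j))))"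
    using fdet_scale_rows[of d "\<lambda>_. l" "\<lambda>i j. G (Suc j) i (y (Suc j))"] by (simp add: G_def)
  also have "\<dots> = fdet d (\<lambda>i j. (1 / l) ^ j * exp (- l * y (Suc j)) * gamma_moment l (Suc j) i (y (Suc j)))"
    using l by (intro fdet_cong) simp
  also have "\<dots> = (\<Prod>j<d. (1 / l) ^ j * exp (- l * y (Suc j))) *
      fdet d (\<lambda>i j. gamma_moment l (Suc j) i (y (Suc j)))"
    by (rule fdet_scale_cols)
  also have "\<dots> = fdet d (\<lambda>i j. G j i (y (Suc j)))"
    by (simp only: G fdet_gamma_moment_Suc[of d l "\<lambda>j. j"])
  finally show "(\<Prod>j\<in>{0<..d}. l) * fdet d (\<lambda>i j. G (Suc j) i (y (Suc j))) =
      fdet d (\<lambda>i j. G j i (y (Suc j)))" .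
qed

text \<open>
  Counted from zero, column \<open>j\<close> belongs to \<open>\<eta>\<^sub>j\<^sub>+\<^sub>1\<close>, which is \<open>Gamma(j, l)\<close> distributed and zero for
  \<open>j = 0\<close>.
\<close>

lemma has_bochner_integral_eta_law_power:
  assumes l: "0 < l"
  shows "has_bochner_integral (eta_law l (Suc j)) (\<lambda>t. t ^ i) (pochhammer (of_nat j) i / l ^ i)"
proof (cases j)
  case 0
  interpret prob_space "return borel (0 :: real)"
    by (rule prob_space_return) simp
  have "integrable (return borel (0 :: real)) (\<lambda>t. t ^ i)"
    by (subst integrable_cong_AE[of _ _ "\<lambda>_. 0 ^ i"]) (auto simp: AE_return)
  then have "has_bochner_integral (return borel (0 :: real)) (\<lambda>t. t ^ i) (0 ^ i)"
    by (simp add: has_bochner_integral_iff integral_return)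
  moreover have "(0 :: real) ^ i = pochhammer 0 i / l ^ i"
    by (cases i) (auto simp: pochhammer_rec)
  ultimately show ?thesis
    using 0 by (simp add: eta_law_def)
next
  case (Suc m)
  have "0 \<le> erlang_density m l t * t ^ i" for t
    using l by (simp add: erlang_density_def)
  moreover have "pochhammer (of_nat (Suc m)) i = (fact (m + i) / fact m :: real)"
    using pochhammer_product[of m "m + i" "1 :: real"]
    by (simp add: pochhammer_fact[symmetric] add.commute)
  ultimately have "has_bochner_integral lborel (\<lambda>t. erlang_density m l t *\<^sub>R t ^ i) (pochhammer (of_nat (Suc m)) i / l ^ i)"
    using nn_integral_erlang_ith_moment[OF l, of m i] l
    by (intro has_bochner_integral_nn_integral) auto
  then have "has_bochner_integral (density lborel (erlang_density m l)) (\<lambda>t. t ^ i)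
      (pochhammer (of_nat (Suc m)) i / l ^ i)"
    using l by (intro has_bochner_integral_density) auto
  then show ?thesis
    using Suc by (simp add: eta_law_def)
qed

lemma has_bochner_integral_eta_law_shifted_power:
  assumes l: "0 < l"
  shows "has_bochner_integral (eta_law l (Suc j)) (\<lambda>t. (y + t) ^ i) (gamma_moment l j i y)"
proof -
  have "has_bochner_integral (eta_law l (Suc j))
      (\<lambda>t. \<Sum>k\<le>i. of_nat (i choose k) * t ^ k * y ^ (i - k)) (gamma_moment l j i y)"
    unfolding gamma_moment_def
    by (intro has_bochner_integral_sum has_bochner_integral_mult_left has_bochner_integral_mult_right
        has_bochner_integral_eta_law_power l)
  moreover have "(\<Sum>k\<le>i. of_nat (i choose k) * t ^ k * y ^ (i - k)) = (y + t) ^ i" for t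
    by (simp add: binomial_ring add.commute[of y t])
  ultimately show ?thesis by simp
qed

text \<open>
  Writing the Vandermonde product as a determinant and expanding it, every term is a product of
  functions of single coordinates; independence allows the expectation to be taken in each entry.
\<close>

lemma h_equal_eq_fdet:
  assumes l: "0 < l"
  shows "h_equal d l x = fdet d (\<lambda>i j. gamma_moment l j i (x (Suc j)))"
proof -
  have "prob_space (eta_law l j)" for j
    using l by (auto simp: eta_law_def prob_space_return prob_space_erlang_density)
  then interpret product_sigma_finite "eta_law l"
    by (simp add: product_sigma_finite_def prob_space_imp_sigma_finite)
  have reindex: "(\<Prod>j\<in>{1..d}. f j) = (\<Prod>i=0..<d. f (Suc i))" for f :: "nat \<Rightarrow> real"
    by (simp add: prod.atLeast1_atMost_eq lessThan_atLeast0)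
  have int: "integrable (eta_law l j) (\<lambda>t. (x j + t) ^ p (j - 1))"
    and val: "(\<integral>t. (x j + t) ^ p (j - 1) \<partial>eta_law l j) = gamma_moment l (j - 1) (p (j - 1)) (x j)"
    if "j \<in> {1..d}" for j and p :: "nat \<Rightarrow> nat"
    using has_bochner_integral_eta_law_shifted_power[OF l, of "j - 1" "x j" "p (j - 1)"] that
    by (auto simp: has_bochner_integral_iff)
  have det: "fdet d (\<lambda>i j. a j i) = (\<Sum>p | p permutes {0..<d}. signof p * (\<Prod>j\<in>{1..d}. a (j - 1) (p (j - 1))))"
    for a
    unfolding reindex by (rule trans[OF fdet_transpose]) (simp add: fdet_leibniz)
  have "vandermonde d (\<lambda>j. x j + \<eta> j) = (\<Prod>j<d. \<Prod>i<j. (x (Suc j) + \<eta> (Suc j)) - (x (Suc i) + \<eta> (Suc i)))" for \<eta>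
    unfolding vandermonde_def
    by (simp add: prod.atLeast1_atMost_eq atLeastLessThanSuc_atLeastAtMost)
  then have "vandermonde d (\<lambda>j. x j + \<eta> j) = fdet d (\<lambda>i j. (x (Suc j) + \<eta> (Suc j)) ^ i)" for \<eta>
    by (simp only: fdet_vandermonde)
  then have vand: "vandermonde d (\<lambda>j. x j + \<eta> j) = (\<Sum>p | p permutes {0..<d}. signof p * (\<Prod>j\<in>{1..d}. (x j + \<eta> j) ^ p (j - 1)))" for \<eta>
    by (simp only: det[of "\<lambda>j i. (x (Suc j) + \<eta> (Suc j)) ^ i"]) (auto intro!: sum.cong prod.cong)
  have prod_val: "(\<integral>\<eta>. (\<Prod>j\<in>{1..d}. (x j + \<eta> j) ^ p (j - 1)) \<partial>(\<Pi>\<^sub>M j\<in>{1..d}. eta_law l j)) =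
      (\<Prod>j\<in>{1..d}. gamma_moment l (j - 1) (p (j - 1)) (x j))" for p
  proof -
    have "(\<integral>\<eta>. (\<Prod>j\<in>{1..d}. (x j + \<eta> j) ^ p (j - 1)) \<partial>(\<Pi>\<^sub>M j\<in>{1..d}. eta_law l j)) =
        (\<Prod>j\<in>{1..d}. \<integral>t. (x j + t) ^ p (j - 1) \<partial>eta_law l j)"
      by (rule product_integral_prod[OF finite_atLeastAtMost int])
    also have "\<dots> = (\<Prod>j\<in>{1..d}. gamma_moment l (j - 1) (p (j - 1)) (x j))"
      by (rule prod.cong[OF refl val])
    finally show ?thesis .
  qed
  have "h_equal d l x = (\<Sum>p | p permutes {0..<d}. signof p *
      (\<integral>\<eta>. (\<Prod>j\<in>{1..d}. (x j + \<eta> j) ^ p (j - 1)) \<partial>(\<Pi>\<^sub>M j\<in>{1..d}. eta_law l j)))"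
    unfolding h_equal_def vand
    by (subst Bochner_Integration.integral_sum)
      (auto intro!: product_integrable_prod integrable_mult_right int)
  also have "\<dots> = (\<Sum>p | p permutes {0..<d}. signof p *
      (\<Prod>j\<in>{1..d}. gamma_moment l (j - 1) (p (j - 1)) (x j)))"
    by (simp only: prod_val)
  also have "\<dots> = fdet d (\<lambda>i j. gamma_moment l j i (x (Suc j)))"
    by (subst det) (auto intro!: sum.cong prod.cong)
  finally show ?thesis .
qed

text \<open>
  The two determinants enter through \<open>expectation_killed_walk\<close>, with constant \<open>l\<^sup>0 l\<^sup>1 \<cdots> l\<^sup>d\<^sup>-\<^sup>1\<close>
  for equal rates and constant \<open>1\<close> for distinct ones.
\<close>

theorem theorem1:
  fixes M :: "'a measure"
    and X :: "nat \<Rightarrow> nat \<Rightarrow> 'a \<Rightarrow> real"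
    and lam :: "nat \<Rightarrow> real"
    and h :: "(nat \<Rightarrow> real) \<Rightarrow> real"
    and d :: nat
  assumes "d \<ge> 1"
    and "prob_space M"
    and "\<And>j. j \<in> {1..d} \<Longrightarrow> lam j > 0"
    and "prob_space.indep_vars M (\<lambda>_. borel) (\<lambda>(i, j). X i j) ({1..} \<times> {1..d})"
    and "\<And>i j. i \<ge> 1 \<Longrightarrow> j \<in> {1..d} \<Longrightarrow>
           distributed M lborel (X i j) (exponential_density (lam j))"
    and "(\<exists>l. (\<forall>j\<in>{1..d}. lam j = l) \<and> h = h_equal d l) \<or>
         ((\<forall>i\<in>{1..d}. \<forall>j\<in>{1..d}. i < j \<longrightarrow> lam i > lam j) \<and> h = h_distinct d lam)"
  shows "\<forall>x\<in>weyl_chamber d. h x > 0 \<and>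
           prob_space.expectation M
             (\<lambda>\<omega>. h (walk X x 1 \<omega>) * indicator {\<omega>. exit_time d X x \<omega> > 1} \<omega>) = h x"
proof
  fix x assume x: "x \<in> weyl_chamber d"
  have d: "0 < d" using assms(1) by simp
  from assms(6) show "h x > 0 \<and> prob_space.expectation M
      (\<lambda>\<omega>. h (walk X x 1 \<omega>) * indicator {\<omega>. exit_time d X x \<omega> > 1} \<omega>) = h x"
  proof (elim disjE exE conjE)
    fix l assume lam: "\<forall>j\<in>{1..d}. lam j = l" and h: "h = h_equal d l"
    have l: "0 < l"
      using lam assms(1) assms(3)[of 1] by auto
    note chain = antiderivative_chain_gamma[OF l x]
    have "h x > 0"
      unfolding h h_equal_eq_fdet[OF l] by (rule chain(3)[OF x])
    moreover have "prob_space.expectation M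
        (\<lambda>\<omega>. h (walk X x 1 \<omega>) * indicator {\<omega>. exit_time d X x \<omega> > 1} \<omega>) = h x"
    proof (rule antiderivative_chain.expectation_killed_walk[OF chain(1) assms(2) d assms(4) _ _ chain(4)])
      show "distributed M lborel (X 1 j) (exponential_density l)" if "j \<in> {0<..d}" for j
        using assms(5)[of 1 j] lam that by simp
      show "h y = (\<Prod>j<d. l ^ j) * (exp (\<Sum>j\<in>{0<..d}. l * y j) *
          fdet d (\<lambda>i j. (1 / l) ^ j * exp (- l * y (Suc j)) * gamma_moment l j i (y (Suc j))))" for y
        unfolding h h_equal_eq_fdet[OF l] by (rule chain(2))
    qed
    ultimately show ?thesis by simp
  next
    assume dec: "\<forall>i\<in>{1..d}. \<forall>j\<in>{1..d}. i < j \<longrightarrow> lam i > lam j" and h: "h = h_distinct d lam"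
    \<comment> \<open>The numbers \<open>lam j\<close> with \<open>j\<close> outside \<open>1, \<dots>, d\<close> may fail to be positive; they are replaced by \<open>1\<close> so that all of the
      exponential laws in the product are probability measures.\<close>
    define lam' where "lam' j = (if j \<in> {1..d} then lam j else 1)" for j
    have pos: "0 < lam' j" for j
      using assms(3) by (simp add: lam'_def)
    have dec': "\<forall>i\<in>{0<..<d}. lam' (Suc i) < lam' i"
      using dec by (simp add: lam'_def)
    note chain = antiderivative_chain_exponential[of lam' d, OF pos dec' x]
    have h': "h y = exp (\<Sum>j\<in>{0<..d}. lam' j * y j) *
        fdet d (\<lambda>i j. lam' (Suc i) powi (int i - int j) * exp (- lam' (Suc i) * y (Suc j)))" for y
    proof -
      have "(\<Sum>j\<in>{0<..d}. lam' j * y j) = (\<Sum>j=1..d. lam j * y j)"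
        by (rule sum.cong) (auto simp: lam'_def)
      moreover have "fdet d (\<lambda>i j. lam' (Suc i) powi (int i - int j) * exp (- lam' (Suc i) * y (Suc j))) =
          fdet d (\<lambda>i j. lam (Suc i) powi (int i - int j) * exp (- lam (Suc i) * y (Suc j)))"
        by (rule fdet_cong) (simp add: lam'_def)
      ultimately show ?thesis
        by (simp add: h h_distinct_def)
    qed
    have "h x > 0"
      unfolding h' by (rule mult_pos_pos[OF exp_gt_zero chain(2)[OF x]])
    moreover have "prob_space.expectation M
        (\<lambda>\<omega>. h (walk X x 1 \<omega>) * indicator {\<omega>. exit_time d X x \<omega> > 1} \<omega>) = h x"
    proof (rule antiderivative_chain.expectation_killed_walk[OF chain(1) assms(2) d assms(4) _ _ chain(3)])
      show "distributed M lborel (X 1 j) (exponential_density (lam' j))" if "j \<in> {0<..d}" for j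
        using assms(5)[of 1 j] that by (simp add: lam'_def)
      show "h y = 1 * (exp (\<Sum>j\<in>{0<..d}. lam' j * y j) *
        fdet d (\<lambda>i j. lam' (Suc i) powi (int i - int j) * exp (- lam' (Suc i) * y (Suc j))))" for y
        by (simp only: h' mult_1_left)
    qed
    ultimately show ?thesis by simp
  qed
qed

end
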